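(* Let $w\in L^1[0,1]$ be real with $w>0$ a.e. on $[0,1]$ and let $\mu\in\mathcal{M}_0^{\mathbb{R}}$. For any positive integer $m$, the $m$-th eigenfunction $y_m(x)$ of the problem $(\mathbf{E}_\mu)$ has exactly $m-1$ zeros on $(0,1)$.
   Context: $\mathcal{M}_0^{\mathbb{R}}$ is the space of normalized real functions of bounded variation: functions $\mu:[0,1]\to\mathbb{R}$ with $\mu(0^+)=0$, $\mu(x^+)=\mu(x)$ for all $x\in(0,1)$, and finite total variation; they are identified with real Borel measures on $[0,1]$. $(\mathbf{E}_\mu)$ is the Dirichlet eigenvalue problem for the measure differential equation $$-\mathrm{d}y^\bullet(x)+y(x)\,\mathrm{d}\mu(x)=\lambda w(x)y(x)\,\mathrm{d}x,\quad x\in[0,1],\qquad y(0)=0=y(1).$$ A solution is a continuous $y$ with generalized derivative $y^\bullet$ such that, for some $(y_0,z_0)$, $y(x)=y_0+\int_{[0,x]}y^\bullet(s)\,\mathrm{d}s$ for $x\in[0,1]$, $y^\bullet(0)=z_0$, and $y^\bullet(x)=z_0+\int_{[0,x]}y(s)\,\mathrm{d}\mu(s)-\lambda\int_{[0,x]}w(s)y(s)\,\mathrm{d}s$ for $x\in(0,1]$ (the $\mathrm{d}\mu$ integral being Riemann–Stieltjes). An eigenvalue is a $\lambda$ for which a nontrivial solution (eigenfunction) satisfying the Dirichlet conditions exists. The eigenvalues are real and simple and form a sequence $\lambda_1<\lambda_2<\cdots\to\infty$; the $m$-th eigenfunction $y_m$ is the (real) eigenfunction, unique up to a nonzero scalar,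 associated with $\lambda_m$. *)

theory Defs
  imports "HOL-Analysis.Analysis"
begin

definition bounded_variation_on :: "(real \<Rightarrow> real) \<Rightarrow> real \<Rightarrow> real \<Rightarrow> bool" where
  "bounded_variation_on g a b \<longleftrightarrow>
     (\<exists>B. \<forall>d. d division_of {a..b} \<longrightarrow> (\<Sum>K\<in>d. \<bar>g (Sup K) - g (Inf K)\<bar>) \<le> B)"

text \<open>Only the values on [0,1] matter. The value at 0 is unconstrained, so that a point
  mass -g(0) at 0 is allowed; likewise g may jump at 1.\<close>

definition normalized_measures :: "(real \<Rightarrow> real) set" where
  "normalized_measures =
     {g. (g \<longlongrightarrow> 0) (at_right 0) \<and>
         (\<forall>x\<in>{0<..<1}. (g \<longlongrightarrow> g x) (at_right x)) \<and>
         bounded_variation_on g 0 1}"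

text \<open>Riemann--Stieltjes integral of f against dg over the closed interval [a,b]:
  the limit of tagged sums as the mesh tends to 0. A constant-radius gauge
  makes \<open>fine\<close> a bound on the mesh, unlike the variable gauges of the
  Henstock--Kurzweil integral.\<close>

definition has_rs_integral ::
  "(real \<Rightarrow> complex) \<Rightarrow> (real \<Rightarrow> real) \<Rightarrow> real \<Rightarrow> real \<Rightarrow> complex \<Rightarrow> bool" where
  "has_rs_integral f g a b I \<longleftrightarrow>
     (\<forall>e>0. \<exists>\<delta>>0. \<forall>p. p tagged_division_of {a..b} \<and> (\<lambda>t. ball t \<delta>) fine p \<longrightarrow>
        norm ((\<Sum>(t, K)\<in>p. complex_of_real (g (Sup K) - g (Inf K)) * f t) - I) < e)"

text \<open>The function z is the generalized derivative of y.\<close>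

definition mde_solution ::
  "(real \<Rightarrow> real) \<Rightarrow> (real \<Rightarrow> real) \<Rightarrow> complex \<Rightarrow> (real \<Rightarrow> complex) \<Rightarrow> (real \<Rightarrow> complex) \<Rightarrow> bool" where
  "mde_solution w \<mu> l y z \<longleftrightarrow>
     continuous_on {0..1} y \<and>
     (\<exists>y0 z0.
        (\<forall>x\<in>{0..1}. y x = y0 + (LINT s:{0..x}|lebesgue. z s)) \<and>
        z 0 = z0 \<and>
        (\<forall>x\<in>{0<..1}. \<exists>I. has_rs_integral y \<mu> 0 x I \<and>
           z x = z0 + I - l * (LINT s:{0..x}|lebesgue. complex_of_real (w s) * y s)))"

definition eigenfunction ::
  "(real \<Rightarrow> real) \<Rightarrow> (real \<Rightarrow> real) \<Rightarrow> complex \<Rightarrow> (real \<Rightarrow> complex) \<Rightarrow> bool" where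
  "eigenfunction w \<mu> l y \<longleftrightarrow>
     (\<exists>z. mde_solution w \<mu> l y z) \<and> y 0 = 0 \<and> y 1 = 0 \<and> (\<exists>x\<in>{0..1}. y x \<noteq> 0)"

definition eigenvalue :: "(real \<Rightarrow> real) \<Rightarrow> (real \<Rightarrow> real) \<Rightarrow> complex \<Rightarrow> bool" where
  "eigenvalue w \<mu> l \<longleftrightarrow> (\<exists>y. eigenfunction w \<mu> l y)"

text \<open>For m at least 1: position m in the increasing enumeration of the eigenvalues, all of
  which are real and simple, so that counting without multiplicity is correct.\<close>

definition mth_eigenvalue :: "(real \<Rightarrow> real) \<Rightarrow> (real \<Rightarrow> real) \<Rightarrow> nat \<Rightarrow> real \<Rightarrow> bool" where
  "mth_eigenvalue w \<mu> m l \<longleftrightarrow>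
     eigenvalue w \<mu> (complex_of_real l) \<and>
     finite {l'. l' < l \<and> eigenvalue w \<mu> (complex_of_real l')} \<and>
     card {l'. l' < l \<and> eigenvalue w \<mu> (complex_of_real l')} = m - 1"

end

theory Submission
  imports Defs
begin

text \<open>
  The proof counts multiples of \<open>\<pi>\<close> passed by a Pruefer angle. Removing the jumps of the
  generalized derivative \<open>z\<close> of a Dirichlet solution by \<open>v = z - \<mu> y\<close> and integrating by parts in
  the Riemann--Stieltjes integral
  turns the measure equation into the first-order system
  \<open>y' = \<mu> y + v\<close>, \<open>v' = - \<mu> v - (\<mu>\<^sup>2 + \<lambda> w) y\<close>, whose coefficients are ordinary integrable
  functions. Every statement about it can therefore be made for indefinite integrals
  (\<open>ac_deriv\<close>). In polar coordinates \<open>y = r sin \<theta>\<close>, \<open>v = r cos \<theta>\<close> the angle satisfies the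
  scalar equation \<open>\<theta>' = (cos \<theta> + \<mu> sin \<theta>)\<^sup>2 + \<lambda> w (sin \<theta>)\<^sup>2\<close> and decouples from \<open>r > 0\<close>. Let
  \<open>\<theta>(x, \<lambda>)\<close> be its solution with \<open>\<theta>(0, \<lambda>) = 0\<close>; a Dirichlet solution for \<open>\<lambda>\<close> is a
  multiple of \<open>r sin \<theta>\<close>, so its zeros are those of \<open>sin \<theta>(x, \<lambda>)\<close>, and \<open>\<lambda>\<close> is an eigenvalue iff
  \<open>sin \<theta>(1, \<lambda>) = 0\<close>.

  Both sides of the theorem count the same set, the positive multiples of \<open>\<pi>\<close> below
  \<open>\<theta>(1, \<lambda>)\<close>. The angle crosses each multiple of \<open>\<pi>\<close> only upward, because the right-hand side
  is 1 there (\<open>angle_crosses_upward\<close>); so each such multiple is taken exactly once as \<open>x\<close> runs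
  through \<open>(0, 1)\<close>. On the other hand \<open>\<theta>(1, k)\<close> is continuous and strictly increasing in \<open>k\<close>
  (\<open>angle_strict_mono\<close>) and is smaller than \<open>\<pi>\<close> for very negative \<open>k\<close> (\<open>angle_small\<close>); so
  each such multiple is also taken exactly once by \<open>\<theta>(1, k)\<close> with \<open>k < \<lambda>\<close>, that is, at
  exactly one eigenvalue below \<open>\<lambda>\<close>.

  Crossing, monotonicity and continuity all follow from one device: the difference \<open>\<delta>\<close> of two
  angles, or of an angle and a constant, satisfies a linear equation \<open>\<delta>' = g \<delta> + r\<close> with an
  explicit \<open>r\<close> of known sign, which an integrating factor solves
  (\<open>ac_deriv_integrating_factor\<close>).
\<close>

section \<open>Calculus of indefinite integrals\<close>

definition ac_deriv :: "(real \<Rightarrow> real) \<Rightarrow> (real \<Rightarrow> real) \<Rightarrow> bool" where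
  "ac_deriv f f' \<longleftrightarrow> f' absolutely_integrable_on {0..1} \<and>
     (\<forall>x\<in>{0..1}. f x - f 0 = integral {0..x} f')"

lemma abs_int_sub:
  fixes f :: "real \<Rightarrow> 'a::euclidean_space"
  assumes "f absolutely_integrable_on {0..1}" "0 \<le> a" "b \<le> 1"
  shows "f absolutely_integrable_on {a..b}"
  by (rule absolutely_integrable_on_subinterval[OF assms(1)]) (use assms in auto)

lemma abs_int_imp_int:
  fixes f :: "real \<Rightarrow> 'a::euclidean_space"
  assumes "f absolutely_integrable_on {0..1}" "0 \<le> a" "b \<le> 1"
  shows "f integrable_on {a..b}"
  using abs_int_sub[OF assms] absolutely_integrable_on_def by blast

lemma ac_derivD:
  assumes "ac_deriv f f'"
  shows "f' absolutely_integrable_on {0..1}" "x \<in> {0..1} \<Longrightarrow> f x = f 0 + integral {0..x} f'"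
  using assms unfolding ac_deriv_def by (blast, metis diff_add_cancel add.commute)

lemma integral_diff_interval:
  fixes f :: "real \<Rightarrow> 'a::euclidean_space"
  assumes "f absolutely_integrable_on {0..1}" "0 \<le> a" "a \<le> b" "b \<le> 1"
  shows "integral {0..b} f - integral {0..a} f = integral {a..b} f"
  using Henstock_Kurzweil_Integration.integral_combine[of 0 a b f]
    abs_int_imp_int[OF assms(1), of 0 b] assms by (simp add: algebra_simps)

lemma ac_deriv_diff:
  assumes "ac_deriv f f'" "0 \<le> a" "a \<le> b" "b \<le> 1"
  shows "f b - f a = integral {a..b} f'"
  using ac_derivD(2)[OF assms(1), of a] ac_derivD(2)[OF assms(1), of b]
    integral_diff_interval[OF ac_derivD(1)[OF assms(1)] assms(2-4)] assms by simp

lemma ac_deriv_continuous: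
  assumes "ac_deriv f f'"
  shows "continuous_on {0..1} f"
proof -
  have "continuous_on {0..1} (\<lambda>x. f 0 + integral {0..x} f')"
    using indefinite_integral_continuous_1[OF abs_int_imp_int[OF ac_derivD(1)[OF assms], of 0 1]]
    by (intro continuous_on_add continuous_on_const) auto
  then show ?thesis
    by (rule continuous_on_eq) (rule ac_derivD(2)[OF assms, symmetric])
qed

lemma ac_deriv_indefinite:
  assumes "g absolutely_integrable_on {0..1}"
  shows "ac_deriv (\<lambda>x. c + integral {0..x} g) g"
  using assms by (simp add: ac_deriv_def)

lemma ac_deriv_cong:
  assumes "ac_deriv f f'" "\<And>x. x \<in> {0..1} \<Longrightarrow> g x = f x" "\<And>x. x \<in> {0..1} \<Longrightarrow> g' x = f' x"
  shows "ac_deriv g g'"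
proof -
  have "g' absolutely_integrable_on {0..1}"
    by (rule absolutely_integrable_spike[OF ac_derivD(1)[OF assms(1)], of "{}"]) (use assms(3) in auto)
  moreover have "integral {0..x} g' = integral {0..x} f'" if "x \<in> {0..1}" for x
    by (rule integral_cong) (use that assms(3) in auto)
  ultimately show ?thesis
    using assms by (auto simp: ac_deriv_def)
qed

lemma ac_deriv_add:
  assumes "ac_deriv f f'" "ac_deriv g g'"
  shows "ac_deriv (\<lambda>x. f x + g x) (\<lambda>x. f' x + g' x)"
proof -
  have "integral {0..x} (\<lambda>x. f' x + g' x) = integral {0..x} f' + integral {0..x} g'" if "x \<in> {0..1}" for x
    by (rule Henstock_Kurzweil_Integration.integral_add)
      (use that abs_int_imp_int[OF ac_derivD(1)] assms in auto)
  then show ?thesis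
    using assms by (auto simp: ac_deriv_def add_diff_add)
qed

lemma ac_deriv_cmult:
  assumes "ac_deriv f f'"
  shows "ac_deriv (\<lambda>x. c * f x) (\<lambda>x. c * f' x)"
  using assms by (auto simp: ac_deriv_def right_diff_distrib[symmetric])

lemma ac_deriv_diff_fun:
  assumes "ac_deriv f f'" "ac_deriv g g'"
  shows "ac_deriv (\<lambda>x. f x - g x) (\<lambda>x. f' x - g' x)"
  using ac_deriv_add[OF assms(1) ac_deriv_cmult[OF assms(2), of "-1"]] by simp

lemma ac_deriv_const: "ac_deriv (\<lambda>x. c) (\<lambda>x. 0)"
  by (auto simp: ac_deriv_def)

text \<open>Cutting the interval into \<open>n\<close> pieces on which \<open>K\<close> grows equally bounds the increment of \<open>G\<close> by
  a multiple of \<open>n \<cdot> (1/n)\<^sup>2\<close>. This replaces differentiation almost everywhere in the chain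
  rule below.\<close>

lemma quadratic_increments_imp_eq:
  fixes G K :: "real \<Rightarrow> real"
  assumes "a \<le> b" "continuous_on {a..b} K"
    and mono: "\<And>s t. a \<le> s \<Longrightarrow> s \<le> t \<Longrightarrow> t \<le> b \<Longrightarrow> K s \<le> K t"
    and quad: "\<And>s t. a \<le> s \<Longrightarrow> s \<le> t \<Longrightarrow> t \<le> b \<Longrightarrow> \<bar>G t - G s\<bar> \<le> C * (K t - K s)^2"
  shows "G b = G a"
proof -
  define D where "D = K b - K a"
  have D: "0 \<le> D" using mono assms(1) by (simp add: D_def)
  have step: "\<bar>G b - G a\<bar> \<le> C * D^2 / real n" if n: "n > 0" for n
  proof -
    have "\<exists>x\<in>{a..b}. K x = K a + real i * D / real n" if "i \<le> n" for i
    proof -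
      have "real i * D / real n \<le> D"
        using that n D mult_right_mono[of "real i" "real n" D] by (simp add: divide_simps mult.commute)
      then have "\<exists>x\<ge>a. x \<le> b \<and> K x = K a + real i * D / real n"
        by (intro IVT') (use assms D in \<open>auto simp: D_def\<close>)
      then show ?thesis by auto
    qed
    then obtain x where x: "\<And>i. i \<le> n \<Longrightarrow> x i \<in> {a..b} \<and> K (x i) = K a + real i * D / real n"
      by metis
    have loc: "\<bar>G (x (Suc i)) - G (x i)\<bar> \<le> C * (D / real n)^2" if "i < n" for i
    proof -
      have K: "K (x (Suc i)) - K (x i) = D / real n"
        using x[of i] x[of "Suc i"] that by (simp add: field_simps)
      have "\<bar>G (x (Suc i)) - G (x i)\<bar> \<le> C * (K (x (Suc i)) - K (x i))^2"
        \<comment> \<open>the chosen points may be out of order when the increment vanishes\<close>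
      proof (cases "x i \<le> x (Suc i)")
        case True
        then show ?thesis using quad[of "x i" "x (Suc i)"] x[of i] x[of "Suc i"] that by simp
      next
        case False
        then have "\<bar>G (x i) - G (x (Suc i))\<bar> \<le> C * (K (x i) - K (x (Suc i)))^2"
          using quad[of "x (Suc i)" "x i"] x[of i] x[of "Suc i"] that by auto
        then show ?thesis by (simp add: power2_commute abs_minus_commute)
      qed
      then show ?thesis using K by simp
    qed
    have "\<bar>G (x n) - G (x 0)\<bar> = \<bar>\<Sum>i<n. G (x (Suc i)) - G (x i)\<bar>"
      using sum_lessThan_telescope[of "\<lambda>i. G (x i)" n] by simp
    also have "\<dots> \<le> (\<Sum>i<n. \<bar>G (x (Suc i)) - G (x i)\<bar>)" by (rule sum_abs)
    also have "\<dots> \<le> (\<Sum>i<n. C * (D / real n)^2)"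
      by (rule sum_mono) (use loc in auto)
    also have "\<dots> = C * D^2 / real n"
      using n by (simp add: power2_eq_square)
    finally have 1: "\<bar>G (x n) - G (x 0)\<bar> \<le> C * D^2 / real n" .
    have "\<bar>G (x 0) - G a\<bar> \<le> C * (K (x 0) - K a)^2" using quad[of a "x 0"] x[of 0] by auto
    then have 2: "G (x 0) = G a" using x[of 0] by simp
    have "\<bar>G b - G (x n)\<bar> \<le> C * (K b - K (x n))^2" using quad[of "x n" b] x[of n] by auto
    then have 3: "G (x n) = G b" using x[of n] n by (simp add: D_def)
    from 1 2 3 show ?thesis by simp
  qed
  have "(\<lambda>n. C * D^2 / real n) \<longlonglongrightarrow> 0"
    by (rule lim_const_over_n)
  then have "\<bar>G b - G a\<bar> \<le> 0"
    by (rule LIMSEQ_le_const) (use step in \<open>auto intro!: exI[of _ 1]\<close>)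
  then show ?thesis by simp
qed

lemma abs_int_cont_mult:
  fixes f g :: "real \<Rightarrow> real"
  assumes "continuous_on {0..1} g" "f absolutely_integrable_on {0..1}"
  shows "(\<lambda>x. g x * f x) absolutely_integrable_on {0..1}"
proof (rule absolutely_integrable_bounded_measurable_product_real)
  show "g \<in> borel_measurable (lebesgue_on {0..1})"
    by (rule continuous_imp_measurable_on_sets_lebesgue[OF assms(1)]) simp
  show "bounded (g ` {0..1})"
    by (intro compact_imp_bounded compact_continuous_image assms(1)) simp
qed (use assms in auto)

lemma integral_abs_bound:
  fixes f g :: "real \<Rightarrow> real"
  assumes "f absolutely_integrable_on {0..1}" "g absolutely_integrable_on {0..1}"
    "0 \<le> a" "b \<le> 1" "\<And>x. x \<in> {a..b} \<Longrightarrow> \<bar>f x\<bar> \<le> g x"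
  shows "\<bar>integral {a..b} f\<bar> \<le> integral {a..b} g"
  using integral_norm_bound_integral[of f "{a..b}" g] abs_int_imp_int assms by auto

lemma ac_deriv_increment_le:
  assumes f: "ac_deriv f f'" and "0 \<le> s" "s \<le> t" "t \<le> 1"
  shows "\<bar>f t - f s\<bar> \<le> integral {s..t} (\<lambda>x. \<bar>f' x\<bar>)"
  unfolding ac_deriv_diff[OF assms]
  by (rule integral_abs_bound) (use assms ac_derivD(1)[OF f] in \<open>auto intro: set_integrable_abs\<close>)

text \<open>With \<open>K = \<integral>\<bar>f'\<bar>\<close> as clock, both \<open>g \<circ> f\<close> and the integral of \<open>g' (f x) f' x\<close> differ on
  \<open>[s, t]\<close> from \<open>g' (f s) (f t - f s)\<close> only by a multiple of \<open>(K t - K s)\<^sup>2\<close>.\<close>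

lemma ac_deriv_chain:
  assumes f: "ac_deriv f f'"
    and g: "\<And>x. (g has_real_derivative g1 x) (at x)"
    and g1: "\<And>x. (g1 has_real_derivative g2 x) (at x)"
    and g2: "continuous_on UNIV g2"
  shows "ac_deriv (\<lambda>x. g (f x)) (\<lambda>x. g1 (f x) * f' x)"
proof -
  note cf = ac_deriv_continuous[OF f] and if' = ac_derivD(1)[OF f]
  have iabs: "(\<lambda>x. \<bar>f' x\<bar>) absolutely_integrable_on {0..1}" using if' by (rule set_integrable_abs)
  have cg1: "continuous_on UNIV g1" using g1 by (meson DERIV_continuous_on has_field_derivative_at_within)
  have cg1f: "continuous_on {0..1} (\<lambda>x. g1 (f x))"
    by (rule continuous_on_compose2[OF cg1 cf]) auto
  have int: "(\<lambda>x. g1 (f x) * f' x) absolutely_integrable_on {0..1}"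
    by (rule abs_int_cont_mult[OF cg1f if'])
  obtain R where R: "\<And>x. x \<in> {0..1} \<Longrightarrow> \<bar>f x\<bar> \<le> R"
    using compact_imp_bounded[OF compact_continuous_image[OF cf compact_Icc]]
    unfolding bounded_iff by (metis image_eqI real_norm_def)
  have "bounded (g2 ` {-R..R})"
    by (intro compact_imp_bounded compact_continuous_image continuous_on_subset[OF g2]) auto
  then obtain C where C: "\<And>x. x \<in> {-R..R} \<Longrightarrow> \<bar>g2 x\<bar> \<le> C"
    unfolding bounded_iff by (metis image_eqI real_norm_def)
  have lip: "\<bar>g1 x - g1 y\<bar> \<le> C * \<bar>x - y\<bar>" if "x \<in> {-R..R}" "y \<in> {-R..R}" for x y
    using field_differentiable_bound[of "{-R..R}" g1 g2 C x y] that C g1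
    by (auto intro: has_field_derivative_at_within)
  define K where "K x = integral {0..x} (\<lambda>x. \<bar>f' x\<bar>)" for x
  have Kdiff: "K t - K s = integral {s..t} (\<lambda>x. \<bar>f' x\<bar>)" if "0 \<le> s" "s \<le> t" "t \<le> 1" for s t
    unfolding K_def using integral_diff_interval[OF iabs that] .
  have Kmono: "K s \<le> K t" if "0 \<le> s" "s \<le> t" "t \<le> 1" for s t
    using Kdiff[OF that] integral_nonneg[of "\<lambda>x. \<bar>f' x\<bar>" "{s..t}"] abs_int_imp_int[OF iabs, of s t] that by auto
  have fK: "\<bar>f t - f s\<bar> \<le> K t - K s" if "0 \<le> s" "s \<le> t" "t \<le> 1" for s t
    using ac_deriv_increment_le[OF f that] Kdiff[OF that] by simp
  have Kcont: "continuous_on {0..1} K"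
    unfolding K_def by (rule indefinite_integral_continuous_1)
      (use abs_int_imp_int[OF iabs, of 0 1] in simp)
  have C0: "0 \<le> C" using C[of "f 0"] R[of 0] by (auto simp: abs_le_iff intro: order_trans[OF abs_ge_zero])
  have key: "\<bar>(g (f t) - integral {0..t} (\<lambda>x. g1 (f x) * f' x)) - (g (f s) - integral {0..s} (\<lambda>x. g1 (f x) * f' x))\<bar>
      \<le> (2 * C) * (K t - K s)^2" if st: "0 \<le> s" "s \<le> t" "t \<le> 1" for s t
  proof -
    have fR: "f r \<in> {-R..R}" if "r \<in> {0..1}" for r using R[OF that] by (auto simp: abs_le_iff)
    have "\<exists>\<xi>. \<bar>\<xi> - f s\<bar> \<le> \<bar>f t - f s\<bar> \<and> \<xi> \<in> {-R..R} \<and> g (f t) - g (f s) = g1 \<xi> * (f t - f s)"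
    proof (cases "f s" "f t" rule: linorder_cases)
      case less
      obtain z where "f s < z" "z < f t" "g (f t) - g (f s) = (f t - f s) * g1 z"
        using MVT2[OF less, of g g1] g by auto
      then show ?thesis using fR[of s] fR[of t] st by (intro exI[of _ z]) auto
    next
      case equal
      then show ?thesis using fR[of s] st by (intro exI[of _ "f s"]) auto
    next
      case greater
      obtain z where "f t < z" "z < f s" "g (f s) - g (f t) = (f s - f t) * g1 z"
        using MVT2[OF greater, of g g1] g by auto
      then show ?thesis using fR[of s] fR[of t] st by (intro exI[of _ z]) (auto simp: algebra_simps)
    qed
    then obtain \<xi> where \<xi>: "\<bar>\<xi> - f s\<bar> \<le> \<bar>f t - f s\<bar>" "\<xi> \<in> {-R..R}"
      "g (f t) - g (f s) = g1 \<xi> * (f t - f s)" by auto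
    have "\<bar>g (f t) - g (f s) - g1 (f s) * (f t - f s)\<bar> = \<bar>g1 \<xi> - g1 (f s)\<bar> * \<bar>f t - f s\<bar>"
      by (simp add: \<xi>(3) abs_mult[symmetric] algebra_simps)
    also have "\<dots> \<le> (C * (K t - K s)) * (K t - K s)"
    proof (rule mult_mono)
      have "\<bar>g1 \<xi> - g1 (f s)\<bar> \<le> C * \<bar>\<xi> - f s\<bar>" using lip[OF \<xi>(2) fR[of s]] st by auto
      also have "\<dots> \<le> C * (K t - K s)" using \<xi>(1) fK[OF st] C0 by (intro mult_left_mono) auto
      finally show "\<bar>g1 \<xi> - g1 (f s)\<bar> \<le> C * (K t - K s)" .
    qed (use fK[OF st] C0 Kmono[OF st] in auto)
    finally have 1: "\<bar>g (f t) - g (f s) - g1 (f s) * (f t - f s)\<bar> \<le> C * (K t - K s)^2"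
      by (simp add: power2_eq_square)
    have intD: "(\<lambda>x. g1 (f x) * f' x - g1 (f s) * f' x) absolutely_integrable_on {0..1}"
      using int if' by auto
    have "\<bar>integral {s..t} (\<lambda>x. g1 (f x) * f' x - g1 (f s) * f' x)\<bar> \<le> integral {s..t} (\<lambda>x. (C * (K t - K s)) * \<bar>f' x\<bar>)"
    proof (rule integral_abs_bound)
      fix x assume x: "x \<in> {s..t}"
      have "\<bar>g1 (f x) - g1 (f s)\<bar> \<le> C * \<bar>f x - f s\<bar>" using lip fR x st by auto
      also have "\<dots> \<le> C * (K t - K s)"
        using fK[of s x] Kmono[of x t] x st C0 by (intro mult_left_mono) auto
      finally show "\<bar>g1 (f x) * f' x - g1 (f s) * f' x\<bar> \<le> C * (K t - K s) * \<bar>f' x\<bar>"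
        by (simp add: left_diff_distrib[symmetric] abs_mult mult_right_mono)
    qed (use intD iabs st in auto)
    also have "\<dots> = C * (K t - K s)^2" using Kdiff[OF st] by (simp add: power2_eq_square)
    finally have 2: "\<bar>integral {s..t} (\<lambda>x. g1 (f x) * f' x - g1 (f s) * f' x)\<bar> \<le> C * (K t - K s)^2" .
    have "integral {s..t} (\<lambda>x. g1 (f x) * f' x - g1 (f s) * f' x)
        = integral {s..t} (\<lambda>x. g1 (f x) * f' x) - g1 (f s) * (f t - f s)"
      using st abs_int_imp_int[OF int] abs_int_imp_int[OF set_integrable_mult_right[of "g1 (f s)", OF if']]
      by (subst Henstock_Kurzweil_Integration.integral_diff) (auto simp: ac_deriv_diff[OF f st])
    then show ?thesis using 1 2 integral_diff_interval[OF int st] by linarith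
  qed
  have "g (f x) - g (f 0) = integral {0..x} (\<lambda>x. g1 (f x) * f' x)" if x: "x \<in> {0..1}" for x
  proof -
    have "g (f x) - integral {0..x} (\<lambda>x. g1 (f x) * f' x) = g (f 0) - integral {0..0} (\<lambda>x. g1 (f x) * f' x)"
      by (rule quadratic_increments_imp_eq[where K=K and C="2*C" and a=0 and b=x
            and G="\<lambda>x. g (f x) - integral {0..x} (\<lambda>x. g1 (f x) * f' x)"])
        (use x Kmono key in \<open>auto intro: continuous_on_subset[OF Kcont]\<close>)
    then show ?thesis by simp
  qed
  then show ?thesis using int by (auto simp: ac_deriv_def)
qed

lemma ac_deriv_power2:
  assumes "ac_deriv f f'"
  shows "ac_deriv (\<lambda>x. (f x)^2) (\<lambda>x. 2 * f x * f' x)"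
  by (rule ac_deriv_chain[OF assms, where ?g2.0="\<lambda>_. 2"]) (auto intro!: derivative_eq_intros)

lemma ac_deriv_exp:
  assumes "ac_deriv f f'"
  shows "ac_deriv (\<lambda>x. exp (f x)) (\<lambda>x. exp (f x) * f' x)"
  by (rule ac_deriv_chain[OF assms, where ?g2.0=exp]) (auto intro!: derivative_eq_intros continuous_intros)

lemma ac_deriv_sin:
  assumes "ac_deriv f f'"
  shows "ac_deriv (\<lambda>x. sin (f x)) (\<lambda>x. cos (f x) * f' x)"
  by (rule ac_deriv_chain[OF assms, where ?g2.0="\<lambda>x. - sin x"]) (auto intro!: derivative_eq_intros continuous_intros)

lemma ac_deriv_cos:
  assumes "ac_deriv f f'"
  shows "ac_deriv (\<lambda>x. cos (f x)) (\<lambda>x. - sin (f x) * f' x)"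
  by (rule ac_deriv_chain[OF assms, where ?g2.0="\<lambda>x. - cos x"]) (auto intro!: derivative_eq_intros continuous_intros)

lemma ac_deriv_mult:
  assumes f: "ac_deriv f f'" and g: "ac_deriv g g'"
  shows "ac_deriv (\<lambda>x. f x * g x) (\<lambda>x. f' x * g x + f x * g' x)"
proof -
  have "ac_deriv (\<lambda>x. (1/2) * ((f x + g x)^2 - (f x)^2 - (g x)^2))
     (\<lambda>x. (1/2) * (2 * (f x + g x) * (f' x + g' x) - 2 * f x * f' x - 2 * g x * g' x))"
    by (intro ac_deriv_cmult ac_deriv_diff_fun ac_deriv_power2 ac_deriv_add f g)
  then show ?thesis
    by (rule ac_deriv_cong) (auto simp: power2_eq_square algebra_simps)
qed

section \<open>Scalar Caratheodory equations\<close>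

text \<open>With \<open>E x = exp (2 \<integral>\<^sub>0\<^sup>x k)\<close> as weight, the Picard operator contracts by one half on the whole
  interval, since \<open>\<integral>\<^sub>0\<^sup>x k E = (E x - 1) / 2\<close>. The unknown of the fixed point problem is
  \<open>\<theta> / E\<close>, extended constantly outside \<open>[0, 1]\<close> to make it a bounded continuous function.\<close>

lemma caratheodory_existence:
  fixes F :: "real \<Rightarrow> real \<Rightarrow> real" and k :: "real \<Rightarrow> real"
  assumes k: "k absolutely_integrable_on {0..1}"
    and lip: "\<And>x s t. x \<in> {0..1} \<Longrightarrow> \<bar>F x s - F x t\<bar> \<le> k x * \<bar>s - t\<bar>"
    and int: "\<And>\<psi>. continuous_on {0..1} \<psi> \<Longrightarrow> (\<lambda>x. F x (\<psi> x)) absolutely_integrable_on {0..1}"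
  obtains \<theta> where "\<theta> 0 = 0" "ac_deriv \<theta> (\<lambda>x. F x (\<theta> x))"
proof -
  have k0: "0 \<le> k x" if "x \<in> {0..1}" for x
    using lip[OF that, of 1 0] by (simp add: order_trans[OF abs_ge_zero])
  define K where "K x = 0 + integral {0..x} k" for x
  have acK: "ac_deriv K k"
    unfolding K_def by (rule ac_deriv_indefinite[OF k])
  define E where "E x = exp (2 * K x)" for x
  have acE: "ac_deriv E (\<lambda>x. E x * (2 * k x))"
    unfolding E_def by (intro ac_deriv_exp ac_deriv_cmult acK)
  have E0: "E 0 = 1" by (simp add: E_def K_def)
  have Epos: "E x > 0" for x by (simp add: E_def)
  have cE: "continuous_on {0..1} E" by (rule ac_deriv_continuous[OF acE])
  have intE: "(\<lambda>x. E x * k x) absolutely_integrable_on {0..1}"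
    by (rule abs_int_cont_mult[OF cE k])
  have intEk: "integral {0..x} (\<lambda>x. E x * k x) = (E x - 1) / 2" if "x \<in> {0..1}" for x
  proof -
    have "E x - 1 = integral {0..x} (\<lambda>x. E x * (2 * k x))"
      using ac_derivD(2)[OF acE that] E0 by simp
    also have "\<dots> = 2 * integral {0..x} (\<lambda>x. E x * k x)"
      by (subst integral_mult_right[symmetric]) (simp add: mult_ac)
    finally show ?thesis by simp
  qed
  define cl :: "real \<Rightarrow> real" where "cl x = max 0 (min 1 x)" for x
  have cl: "cl x \<in> {0..1}" for x by (auto simp: cl_def)
  have ccl: "continuous_on UNIV cl" unfolding cl_def by (intro continuous_intros)
  define Phi where "Phi \<eta> x = inverse (E x) * integral {0..x} (\<lambda>s. F s (E s * \<eta> s))" for \<eta> x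
  have intF: "(\<lambda>s. F s (E s * \<eta> s)) absolutely_integrable_on {0..1}" if "continuous_on {0..1} \<eta>" for \<eta>
    by (rule int) (intro continuous_on_mult cE that)
  have cPhi: "continuous_on {0..1} (Phi \<eta>)" if "continuous_on {0..1} \<eta>" for \<eta>
    unfolding Phi_def
    using indefinite_integral_continuous_1[OF abs_int_imp_int[OF intF[OF that], of 0 1]] Epos
    by (intro continuous_on_mult continuous_on_inverse cE) (auto simp: less_imp_neq[symmetric])
  define T :: "(real \<Rightarrow>\<^sub>C real) \<Rightarrow> (real \<Rightarrow>\<^sub>C real)" where
    "T \<eta> = Bcontfun (\<lambda>x. Phi (apply_bcontfun \<eta>) (cl x))" for \<eta>
  have T: "apply_bcontfun (T \<eta>) x = Phi (apply_bcontfun \<eta>) (cl x)" for \<eta> x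
  proof -
    have c: "continuous_on {0..1} (Phi (apply_bcontfun \<eta>))" by (rule cPhi) simp
    have "(\<lambda>x. Phi (apply_bcontfun \<eta>) (cl x)) \<in> bcontfun"
      unfolding bcontfun_def
    proof safe
      show "continuous_on UNIV (\<lambda>x. Phi (apply_bcontfun \<eta>) (cl x))"
        by (rule continuous_on_compose2[OF c ccl]) (use cl in auto)
      have "bounded (Phi (apply_bcontfun \<eta>) ` {0..1})"
        by (intro compact_imp_bounded compact_continuous_image c) simp
      then show "bounded (range (\<lambda>x. Phi (apply_bcontfun \<eta>) (cl x)))"
        by (rule bounded_subset) (use cl in auto)
    qed
    then show ?thesis unfolding T_def by (simp add: Bcontfun_inverse)
  qed
  have "\<exists>!\<eta>. T \<eta> = \<eta>"
  proof (rule banach_fix_type[of "1/2"], goal_cases)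
    case 3
    show ?case
    proof safe
      fix \<eta> \<zeta> :: "real \<Rightarrow>\<^sub>C real"
      show "dist (T \<eta>) (T \<zeta>) \<le> 1/2 * dist \<eta> \<zeta>"
      proof (rule dist_bound)
        fix x0
        define x where "x = cl x0"
        have x: "x \<in> {0..1}" using cl by (simp add: x_def)
        note i1 = intF[of "apply_bcontfun \<eta>", simplified] and i2 = intF[of "apply_bcontfun \<zeta>", simplified]
        let ?d = "dist \<eta> \<zeta>"
        have "\<bar>integral {0..x} (\<lambda>s. F s (E s * \<eta> s) - F s (E s * \<zeta> s))\<bar> \<le> integral {0..x} (\<lambda>s. ?d * (E s * k s))"
        proof (rule integral_abs_bound)
          fix s assume s: "s \<in> {0..x}"
          then have s1: "s \<in> {0..1}" using x by auto
          have "\<bar>F s (E s * \<eta> s) - F s (E s * \<zeta> s)\<bar> \<le> k s * \<bar>E s * \<eta> s - E s * \<zeta> s\<bar>"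
            by (rule lip[OF s1])
          also have "\<dots> = k s * (E s * \<bar>\<eta> s - \<zeta> s\<bar>)"
            using Epos[of s] by (simp add: right_diff_distrib[symmetric] abs_mult)
          also have "\<dots> \<le> k s * (E s * ?d)"
            using k0[OF s1] Epos[of s] dist_bounded[of \<eta> s \<zeta>]
            by (intro mult_left_mono) (auto simp: dist_real_def)
          finally show "\<bar>F s (E s * \<eta> s) - F s (E s * \<zeta> s)\<bar> \<le> ?d * (E s * k s)" by (simp add: mult_ac)
        qed (use i1 i2 intE x in auto)
        also have "\<dots> = ?d * ((E x - 1) / 2)" using intEk[OF x] by simp
        also have "\<dots> \<le> ?d * (E x / 2)" by (intro mult_left_mono) auto
        finally have *: "\<bar>integral {0..x} (\<lambda>s. F s (E s * \<eta> s) - F s (E s * \<zeta> s))\<bar> \<le> ?d * (E x / 2)" .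
        have "dist (T \<eta> x0) (T \<zeta> x0) = inverse (E x) * \<bar>integral {0..x} (\<lambda>s. F s (E s * \<eta> s) - F s (E s * \<zeta> s))\<bar>"
          unfolding T Phi_def x_def[symmetric] dist_real_def
          using x Epos[of x] by (subst Henstock_Kurzweil_Integration.integral_diff)
            (auto simp: abs_int_imp_int[OF i1] abs_int_imp_int[OF i2] right_diff_distrib[symmetric] abs_mult)
        also have "\<dots> \<le> inverse (E x) * (?d * (E x / 2))"
          using * Epos[of x] by (intro mult_left_mono) auto
        also have "\<dots> = 1/2 * ?d" using Epos[of x] by (simp add: field_simps)
        finally show "dist (T \<eta> x0) (T \<zeta> x0) \<le> 1/2 * ?d" .
      qed
    qed
  qed auto
  then obtain \<eta> where \<eta>: "T \<eta> = \<eta>" by auto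
  define \<theta> where "\<theta> x = E x * \<eta> x" for x
  have eq: "\<theta> x = integral {0..x} (\<lambda>s. F s (\<theta> s))" if "x \<in> {0..1}" for x
  proof -
    have "\<eta> x = Phi (apply_bcontfun \<eta>) x"
      using T[of \<eta> x] \<eta> that by (simp add: cl_def)
    then show ?thesis using Epos[of x] by (simp add: \<theta>_def Phi_def)
  qed
  have "\<theta> 0 = 0" using eq[of 0] by simp
  moreover have "ac_deriv \<theta> (\<lambda>x. F x (\<theta> x))"
    unfolding ac_deriv_def using intF[of "apply_bcontfun \<eta>"] eq \<open>\<theta> 0 = 0\<close>
    by (auto simp: \<theta>_def)
  ultimately show thesis by (rule that)
qed

text \<open>The quotient \<open>g = (\<delta>' - r) / \<delta>\<close> is bounded by \<open>k\<close>, also where \<open>\<delta>\<close> vanishes, so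
  \<open>\<delta>' = g \<delta> + r\<close> is a linear equation with integrable coefficients and \<open>E = exp (- \<integral> g)\<close> is an
  integrating factor. The two-sided bound on \<open>E\<close> does not involve \<open>\<delta>\<close>.\<close>

lemma ac_deriv_integrating_factor:
  assumes d: "ac_deriv \<delta> \<delta>'" and r: "r absolutely_integrable_on {0..1}"
    and k: "k absolutely_integrable_on {0..1}"
    and le: "\<And>x. x \<in> {0..1} \<Longrightarrow> \<bar>\<delta>' x - r x\<bar> \<le> k x * \<bar>\<delta> x\<bar>"
    and k0: "\<And>x. x \<in> {0..1} \<Longrightarrow> 0 \<le> k x"
  obtains E where "\<And>x. x \<in> {0..1} \<Longrightarrow> exp (- integral {0..1} k) \<le> E x \<and> E x \<le> exp (integral {0..1} k)"
    "ac_deriv (\<lambda>x. E x * \<delta> x) (\<lambda>x. E x * r x)"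
proof -
  define g where "g x = (\<delta>' x - r x) / \<delta> x" for x
  have gk: "\<bar>g x\<bar> \<le> k x" if "x \<in> {0..1}" for x
    using le[OF that] k0[OF that] by (auto simp: g_def abs_divide divide_simps)
  have g: "g absolutely_integrable_on {0..1}"
  proof (rule measurable_bounded_by_integrable_imp_absolutely_integrable)
    have "\<delta> \<in> borel_measurable (lebesgue_on {0..1})"
      by (rule continuous_imp_measurable_on_sets_lebesgue[OF ac_deriv_continuous[OF d]]) simp
    then show "g \<in> borel_measurable (lebesgue_on {0..1})"
      unfolding g_def using absolutely_integrable_imp_borel_measurable[OF r]
        absolutely_integrable_imp_borel_measurable[OF ac_derivD(1)[OF d]]
      by (intro borel_measurable_divide borel_measurable_diff) auto
    show "k integrable_on {0..1}" using abs_int_imp_int[OF k, of 0 1] by simp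
  qed (use gk in auto)
  define E where "E x = exp (-1 * (0 + integral {0..x} g))" for x
  have acE: "ac_deriv E (\<lambda>x. E x * (-1 * g x))"
    unfolding E_def by (intro ac_deriv_exp ac_deriv_cmult ac_deriv_indefinite g)
  have "ac_deriv (\<lambda>x. E x * \<delta> x) (\<lambda>x. (E x * (-1 * g x)) * \<delta> x + E x * \<delta>' x)"
    by (intro ac_deriv_mult acE d)
  then have "ac_deriv (\<lambda>x. E x * \<delta> x) (\<lambda>x. E x * r x)"
  proof (rule ac_deriv_cong)
    fix x :: real assume x: "x \<in> {0..1}"
    have "\<delta>' x = g x * \<delta> x + r x"
      using le[OF x] by (cases "\<delta> x = 0") (auto simp: g_def)
    then show "E x * r x = (E x * (-1 * g x)) * \<delta> x + E x * \<delta>' x" by (simp add: algebra_simps)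
  qed auto
  moreover have "exp (- integral {0..1} k) \<le> E x \<and> E x \<le> exp (integral {0..1} k)" if x: "x \<in> {0..1}" for x
  proof -
    have "\<bar>integral {0..x} g\<bar> \<le> integral {0..x} k"
      by (rule integral_abs_bound[OF g k]) (use x gk in auto)
    also have "\<dots> \<le> integral {0..1} k"
      using x k0 by (intro integral_subset_le abs_int_imp_int[OF k]) auto
    finally show ?thesis by (auto simp: E_def abs_le_iff)
  qed
  ultimately show thesis using that by blast
qed

section \<open>The Pruefer angle\<close>

lemma integral_pos:
  fixes f :: "real \<Rightarrow> real"
  assumes f: "f absolutely_integrable_on {0..1}" and ab: "0 \<le> a" "a < b" "b \<le> 1"
    and pos: "\<And>x. x \<in> {a<..b} \<Longrightarrow> 0 < f x" and "0 \<le> f a"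
  shows "0 < integral {a..b} f"
proof -
  have fa: "f absolutely_integrable_on {a..b}" by (rule abs_int_sub[OF f]) (use ab in auto)
  have nn: "0 \<le> f x" if "x \<in> {a..b}" for x
    using pos[of x] that assms(6) by (cases "x = a") auto
  have "0 \<le> integral {a..b} f"
    by (rule integral_nonneg) (use nn abs_int_imp_int[OF f] ab in auto)
  moreover have "integral {a..b} f \<noteq> 0"
  proof
    assume "integral {a..b} f = 0"
    then have "integral\<^sup>L lebesgue (\<lambda>x. indicator {a..b} x *\<^sub>R f x) = 0"
      using set_lebesgue_integral_eq_integral(2)[OF fa] by (simp add: set_lebesgue_integral_def)
    then have "AE x in lebesgue. indicator {a..b} x *\<^sub>R f x = 0"
      by (subst (asm) integral_nonneg_eq_0_iff_AE)
        (use fa nn in \<open>auto simp: set_integrable_def indicator_def\<close>)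
    then have "AE x in lebesgue. x \<notin> {a<..b}"
      by eventually_elim (use pos in \<open>force simp: indicator_def split: if_splits\<close>)
    then have "emeasure lebesgue {a<..b} = 0"
      by (subst (asm) AE_iff_measurable[where N="{a<..b}"]) auto
    then show False using ab by simp
  qed
  ultimately show ?thesis by simp
qed

lemma abs_sin_diff_le: "\<bar>sin s - sin t\<bar> \<le> \<bar>s - t\<bar>" for s t :: real
  using field_differentiable_bound[of UNIV sin cos 1 s t]
  by (auto intro!: DERIV_sin)

lemma abs_cos_diff_le: "\<bar>cos s - cos t\<bar> \<le> \<bar>s - t\<bar>" for s t :: real
  using field_differentiable_bound[of UNIV cos "\<lambda>x. - sin x" 1 s t]
  by (auto intro!: DERIV_cos)

locale prufer =
  fixes w \<mu> :: "real \<Rightarrow> real" and M :: real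
  assumes w_int: "w absolutely_integrable_on {0..1}"
    and w_pos: "\<And>x. x \<in> {0..1} \<Longrightarrow> 0 < w x"
    and mu_meas: "\<mu> \<in> borel_measurable (lebesgue_on {0..1})"
    and mu_bound: "\<And>x. x \<in> {0..1} \<Longrightarrow> \<bar>\<mu> x\<bar> \<le> M"
begin

text \<open>The right-hand side of the equation for the angle \<open>\<theta>\<close> of \<open>(v, y) = r (cos \<theta>, sin \<theta>)\<close>, where
  \<open>v = z - \<mu> y\<close> and \<open>z\<close> is the generalized derivative of \<open>y\<close>.\<close>

definition speed :: "real \<Rightarrow> real \<Rightarrow> real \<Rightarrow> real" where
  "speed l x t = (cos t + \<mu> x * sin t)^2 + l * w x * (sin t)^2"

definition lip :: "real \<Rightarrow> real \<Rightarrow> real" where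
  "lip l x = 2 * (1 + M)^2 + 2 * \<bar>l\<bar> * w x"

lemma M_nonneg: "0 \<le> M"
  using mu_bound[of 0] by (auto intro: order_trans[OF abs_ge_zero])

lemma lip_int: "lip l absolutely_integrable_on {0..1}"
  unfolding lip_def by (intro set_integral_add set_integrable_mult_right w_int) auto

lemma lip_nonneg: "x \<in> {0..1} \<Longrightarrow> 0 \<le> lip l x"
  using w_pos[of x] by (simp add: lip_def)

lemma first_term_bound:
  assumes "x \<in> {0..1}"
  shows "\<bar>cos t + \<mu> x * sin t\<bar> \<le> 1 + M"
proof -
  have "\<bar>\<mu> x * sin t\<bar> \<le> M * 1"
    unfolding abs_mult by (rule mult_mono) (use mu_bound[OF assms] M_nonneg in auto)
  then show ?thesis using abs_cos_le_one[of t] by linarith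
qed

lemma square_first_term_bound:
  assumes "x \<in> {0..1}"
  shows "(cos t + \<mu> x * sin t)^2 \<le> (1 + M)^2"
  using first_term_bound[OF assms] abs_le_square_iff[of "cos t + \<mu> x * sin t" "1 + M"] M_nonneg by simp

lemma speed_lipschitz:
  assumes x: "x \<in> {0..1}"
  shows "\<bar>speed l x s - speed l x t\<bar> \<le> lip l x * \<bar>s - t\<bar>"
proof -
  let ?A = "\<lambda>t. cos t + \<mu> x * sin t"
  have "\<bar>?A s - ?A t\<bar> \<le> \<bar>cos s - cos t\<bar> + \<bar>\<mu> x\<bar> * \<bar>sin s - sin t\<bar>"
    unfolding abs_mult[symmetric] by (simp add: right_diff_distrib)
  also have "\<dots> \<le> \<bar>s - t\<bar> + M * \<bar>s - t\<bar>"
    by (intro add_mono mult_mono abs_cos_diff_le abs_sin_diff_le mu_bound x M_nonneg abs_ge_zero)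
  finally have 1: "\<bar>?A s - ?A t\<bar> \<le> (1 + M) * \<bar>s - t\<bar>" by (simp add: algebra_simps)
  have 2: "\<bar>?A s + ?A t\<bar> \<le> 2 * (1 + M)"
    by (rule order_trans[OF abs_triangle_ineq])
      (use add_mono[OF first_term_bound[OF x, of s] first_term_bound[OF x, of t]] in simp)
  have "\<bar>(?A s)^2 - (?A t)^2\<bar> = \<bar>?A s - ?A t\<bar> * \<bar>?A s + ?A t\<bar>"
    by (simp add: abs_mult[symmetric] power2_eq_square algebra_simps)
  also have "\<dots> \<le> ((1 + M) * \<bar>s - t\<bar>) * (2 * (1 + M))"
    using 1 2 M_nonneg by (intro mult_mono) auto
  finally have 3: "\<bar>(?A s)^2 - (?A t)^2\<bar> \<le> 2 * (1 + M)^2 * \<bar>s - t\<bar>"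
    by (simp add: power2_eq_square mult_ac)
  have "\<bar>(sin s)^2 - (sin t)^2\<bar> = \<bar>sin s - sin t\<bar> * \<bar>sin s + sin t\<bar>"
    by (simp add: abs_mult[symmetric] power2_eq_square algebra_simps)
  also have "\<dots> \<le> \<bar>s - t\<bar> * 2"
    using abs_sin_le_one[of s] abs_sin_le_one[of t]
    by (intro mult_mono abs_sin_diff_le) linarith+
  finally have "\<bar>l * w x\<bar> * \<bar>(sin s)^2 - (sin t)^2\<bar> \<le> \<bar>l * w x\<bar> * (\<bar>s - t\<bar> * 2)"
    by (rule mult_left_mono) simp
  then have 4: "\<bar>l * w x * ((sin s)^2 - (sin t)^2)\<bar> \<le> 2 * \<bar>l\<bar> * w x * \<bar>s - t\<bar>"
    using w_pos[OF x] by (simp add: abs_mult mult_ac)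
  have "speed l x s - speed l x t = ((?A s)^2 - (?A t)^2) + l * w x * ((sin s)^2 - (sin t)^2)"
    by (simp add: speed_def algebra_simps)
  then show ?thesis using 3 4 by (simp add: lip_def algebra_simps)
qed

lemma w_sin_int:
  assumes "continuous_on {0..1} \<psi>"
  shows "(\<lambda>x. w x * (sin (\<psi> x))^2) absolutely_integrable_on {0..1}"
  using abs_int_cont_mult[OF _ w_int, of "\<lambda>x. (sin (\<psi> x))^2"] assms
  by (simp add: mult.commute continuous_intros)

lemma speed_int:
  assumes \<psi>: "continuous_on {0..1} \<psi>"
  shows "(\<lambda>x. speed l x (\<psi> x)) absolutely_integrable_on {0..1}"
proof -
  have m: "(\<lambda>x. g (\<psi> x)) \<in> borel_measurable (lebesgue_on {0..1})" if "continuous_on UNIV g"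
    for g :: "real \<Rightarrow> real"
    by (rule continuous_imp_measurable_on_sets_lebesgue)
      (auto intro: continuous_on_compose2[OF that \<psi>])
  have "(\<lambda>x. (cos (\<psi> x) + \<mu> x * sin (\<psi> x))^2) absolutely_integrable_on {0..1}"
  proof (rule measurable_bounded_by_integrable_imp_absolutely_integrable)
    show "(\<lambda>x. (cos (\<psi> x) + \<mu> x * sin (\<psi> x))^2) \<in> borel_measurable (lebesgue_on {0..1})"
      by (intro borel_measurable_power borel_measurable_add borel_measurable_times mu_meas m continuous_intros)
    show "(\<lambda>x::real. (1 + M)^2) integrable_on {0..1}" by (rule integrable_const_ivl)
  qed (use square_first_term_bound in auto)
  moreover have "(\<lambda>x. l * (w x * (sin (\<psi> x))^2)) absolutely_integrable_on {0..1}"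
    by (intro set_integrable_mult_right w_sin_int \<psi>)
  ultimately show ?thesis unfolding speed_def mult.assoc by (rule set_integral_add)
qed

definition angle :: "real \<Rightarrow> real \<Rightarrow> real" where
  "angle l = (SOME \<theta>. \<theta> 0 = 0 \<and> ac_deriv \<theta> (\<lambda>x. speed l x (\<theta> x)))"

lemma angle: "angle l 0 = 0" "ac_deriv (angle l) (\<lambda>x. speed l x (angle l x))"
proof -
  obtain \<theta> where "\<theta> 0 = 0" "ac_deriv \<theta> (\<lambda>x. speed l x (\<theta> x))"
    using caratheodory_existence[OF lip_int speed_lipschitz speed_int] by metis
  then have "\<exists>\<theta>. \<theta> 0 = 0 \<and> ac_deriv \<theta> (\<lambda>x. speed l x (\<theta> x))" by blast
  then show "angle l 0 = 0" "ac_deriv (angle l) (\<lambda>x. speed l x (angle l x))"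
    unfolding angle_def by (rule someI2_ex; blast)+
qed

lemma angle_continuous: "continuous_on {0..1} (angle l)"
  by (rule ac_deriv_continuous[OF angle(2)])

text \<open>At a multiple of \<open>\<pi>\<close> the speed is 1 for every \<open>x\<close>, since the weight term drops out there; so the constant
  \<open>n \<pi>\<close> is a strict subsolution.\<close>

lemma angle_crosses_upward:
  assumes "0 \<le> a" "a < x" "x \<le> 1" and n: "of_int n * pi \<le> angle l a"
  shows "of_int n * pi < angle l x"
proof -
  let ?\<delta> = "\<lambda>x. angle l x - of_int n * pi"
  have sn: "sin (of_int n * pi) = 0" by (simp add: sin_zero_iff_int2)
  then have cn: "(cos (of_int n * pi))^2 = 1" using sin_cos_squared_add[of "of_int n * pi"] by simp
  have ac: "ac_deriv ?\<delta> (\<lambda>x. speed l x (angle l x) - 0)"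
    by (intro ac_deriv_diff_fun angle ac_deriv_const)
  have le: "\<bar>(speed l x (angle l x) - 0) - 1\<bar> \<le> lip l x * \<bar>?\<delta> x\<bar>" if "x \<in> {0..1}" for x
    using speed_lipschitz[OF that, of l "angle l x" "of_int n * pi"] sn cn by (simp add: speed_def)
  obtain E where E: "\<And>x. x \<in> {0..1} \<Longrightarrow> exp (- integral {0..1} (lip l)) \<le> E x \<and> E x \<le> exp (integral {0..1} (lip l))"
    and acE: "ac_deriv (\<lambda>x. E x * ?\<delta> x) (\<lambda>x. E x * 1)"
    using ac_deriv_integrating_factor[OF ac _ lip_int le lip_nonneg] by auto
  have Epos: "0 < E x" if "x \<in> {0..1}" for x
    using E[OF that] exp_gt_zero less_le_trans by blast
  have "0 < integral {a..x} (\<lambda>x. E x * 1)"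
    by (rule integral_pos[OF ac_derivD(1)[OF acE]]) (use assms Epos less_imp_le[OF Epos] in auto)
  also have "\<dots> = E x * ?\<delta> x - E a * ?\<delta> a"
    by (rule ac_deriv_diff[OF acE, symmetric]) (use assms in auto)
  also have "\<dots> \<le> E x * ?\<delta> x"
    using n less_imp_le[OF Epos[of a]] assms by simp
  finally show ?thesis using Epos[of x] assms by (simp add: zero_less_mult_iff)
qed

lemma angle_pos: "x \<in> {0<..1} \<Longrightarrow> 0 < angle l x"
  using angle_crosses_upward[of 0 x 0 l] angle(1)[of l] by simp

text \<open>Only the Lipschitz constant at the parameter \<open>k\<close> enters, so the bounds on \<open>E\<close> are uniform
  in \<open>l\<close>, which is what continuity at \<open>k\<close> needs.\<close>

lemma angle_difference:
  obtains E where "\<And>x. x \<in> {0..1} \<Longrightarrow> exp (- integral {0..1} (lip k)) \<le> E x \<and> E x \<le> exp (integral {0..1} (lip k))"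
    "ac_deriv (\<lambda>x. E x * (angle k x - angle l x)) (\<lambda>x. E x * ((k - l) * (w x * (sin (angle l x))^2)))"
proof (rule ac_deriv_integrating_factor)
  show "ac_deriv (\<lambda>x. angle k x - angle l x) (\<lambda>x. speed k x (angle k x) - speed l x (angle l x))"
    by (intro ac_deriv_diff_fun angle)
  show "(\<lambda>x. (k - l) * (w x * (sin (angle l x))^2)) absolutely_integrable_on {0..1}"
    by (intro set_integrable_mult_right w_sin_int angle_continuous)
  show "\<bar>speed k x (angle k x) - speed l x (angle l x) - (k - l) * (w x * (sin (angle l x))^2)\<bar>
      \<le> lip k x * \<bar>angle k x - angle l x\<bar>" if "x \<in> {0..1}" for x
    using speed_lipschitz[OF that, of k "angle k x" "angle l x"] by (simp add: speed_def algebra_simps)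
qed (use lip_int lip_nonneg in auto)

lemma sin_angle_pos_near_0:
  obtains e where "0 < e" "e \<le> 1" "\<And>x. x \<in> {0<..e} \<Longrightarrow> 0 < sin (angle l x)"
proof -
  have "0 < pi" by simp
  then obtain d where d: "d > 0" "\<And>x. x \<in> {0..1} \<Longrightarrow> dist x 0 < d \<Longrightarrow> dist (angle l x) (angle l 0) < pi"
    using angle_continuous[of l] unfolding continuous_on_iff by (metis atLeastAtMost_iff order_refl zero_le_one)
  define e where "e = min (d / 2) 1"
  have e: "0 < e" "e \<le> 1" "e < d" using d(1) by (auto simp: e_def min_def)
  have "0 < sin (angle l x)" if x: "x \<in> {0<..e}" for x
  proof (rule sin_gt_zero)
    show "0 < angle l x" "angle l x < pi"
      using x angle_pos[of x l] d(2)[of x] e angle(1)[of l] by (auto simp: dist_real_def)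
  qed
  then show thesis using that e by blast
qed

lemma angle_strict_mono:
  assumes "l < k"
  shows "angle l 1 < angle k 1"
proof -
  obtain E where E: "\<And>x. x \<in> {0..1} \<Longrightarrow> exp (- integral {0..1} (lip k)) \<le> E x \<and> E x \<le> exp (integral {0..1} (lip k))"
    and ac: "ac_deriv (\<lambda>x. E x * (angle k x - angle l x)) (\<lambda>x. E x * ((k - l) * (w x * (sin (angle l x))^2)))"
      (is "ac_deriv _ ?r")
    using angle_difference[of k l] by blast
  have Epos: "0 < E x" if "x \<in> {0..1}" for x
    using E[OF that] exp_gt_zero less_le_trans by blast
  obtain e where e: "0 < e" "e \<le> 1" and sin: "\<And>x. x \<in> {0<..e} \<Longrightarrow> 0 < sin (angle l x)"
    using sin_angle_pos_near_0[of l] by blast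
  have nn: "0 \<le> ?r x" if "x \<in> {0..1}" for x
    using Epos[OF that] w_pos[OF that] assms by (auto intro!: mult_nonneg_nonneg)
  have "0 < integral {0..e} ?r"
  proof (rule integral_pos[OF ac_derivD(1)[OF ac]])
    fix x assume x: "x \<in> {0<..e}"
    have "sin (angle l x) > 0" by (rule sin[OF x])
    then show "0 < ?r x" using x e Epos[of x] w_pos[of x] assms by auto
  qed (use e nn in auto)
  also have "\<dots> \<le> integral {0..1} ?r"
    using e nn by (intro integral_subset_le abs_int_imp_int[OF ac_derivD(1)[OF ac]]) auto
  also have "\<dots> = E 1 * (angle k 1 - angle l 1)"
    using ac_derivD(2)[OF ac, of 1] angle(1) by simp
  finally show ?thesis using Epos[of 1] by (simp add: zero_less_mult_iff)
qed

lemma angle_lipschitz_at: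
  "\<bar>angle k 1 - angle l 1\<bar> \<le> exp (2 * integral {0..1} (lip k)) * integral {0..1} w * \<bar>k - l\<bar>"
proof -
  let ?L = "integral {0..1} (lip k)"
  obtain E where E: "\<And>x. x \<in> {0..1} \<Longrightarrow> exp (- ?L) \<le> E x \<and> E x \<le> exp ?L"
    and ac: "ac_deriv (\<lambda>x. E x * (angle k x - angle l x)) (\<lambda>x. E x * ((k - l) * (w x * (sin (angle l x))^2)))"
      (is "ac_deriv _ ?r")
    using angle_difference[of k l] by blast
  have "\<bar>E 1 * (angle k 1 - angle l 1)\<bar> = \<bar>integral {0..1} ?r\<bar>"
    using ac_derivD(2)[OF ac, of 1] angle(1) by simp
  also have "\<dots> \<le> integral {0..1} (\<lambda>x. (exp ?L * \<bar>k - l\<bar>) * w x)"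
  proof (rule integral_abs_bound[OF ac_derivD(1)[OF ac]])
    fix x :: real assume x: "x \<in> {0..1}"
    have e0: "0 \<le> E x" using E[OF x] exp_ge_zero order_trans by blast
    have "\<bar>?r x\<bar> = E x * \<bar>k - l\<bar> * (w x * (sin (angle l x))^2)"
      using e0 w_pos[OF x] by (simp add: abs_mult)
    also have "\<dots> \<le> (exp ?L * \<bar>k - l\<bar>) * (w x * 1)"
      using E[OF x] e0 w_pos[OF x] by (intro mult_mono) (auto simp: abs_square_le_1)
    finally show "\<bar>?r x\<bar> \<le> (exp ?L * \<bar>k - l\<bar>) * w x" by simp
  qed (use w_int in auto)
  also have "\<dots> = exp ?L * \<bar>k - l\<bar> * integral {0..1} w" by simp
  finally have 1: "\<bar>E 1\<bar> * \<bar>angle k 1 - angle l 1\<bar> \<le> exp ?L * \<bar>k - l\<bar> * integral {0..1} w"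
    by (simp add: abs_mult)
  have "exp (- ?L) * \<bar>angle k 1 - angle l 1\<bar> \<le> \<bar>E 1\<bar> * \<bar>angle k 1 - angle l 1\<bar>"
    using E[of 1] by (intro mult_right_mono) auto
  with 1 have "exp ?L * (exp (- ?L) * \<bar>angle k 1 - angle l 1\<bar>) \<le> exp ?L * (exp ?L * \<bar>k - l\<bar> * integral {0..1} w)"
    by (intro mult_left_mono) auto
  moreover have "exp ?L * exp (- ?L) = 1" by (simp add: exp_minus)
  moreover have "exp (2 * ?L) = exp ?L * exp ?L" by (simp add: exp_add[symmetric])
  ultimately show ?thesis by (simp add: mult.assoc[symmetric]) (simp add: mult_ac)
qed

lemma angle_continuous_parameter: "continuous_on UNIV (\<lambda>l. angle l 1)"
  unfolding continuous_on_def
proof safe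
  fix k
  let ?C = "exp (2 * integral {0..1} (lip k)) * integral {0..1} w"
  have "((\<lambda>l. ?C * \<bar>k - l\<bar>) \<longlongrightarrow> ?C * \<bar>k - k\<bar>) (at k)"
    by (intro tendsto_intros)
  then have "((\<lambda>l. ?C * \<bar>k - l\<bar>) \<longlongrightarrow> 0) (at k)" by simp
  then have "((\<lambda>l. angle l 1 - angle k 1) \<longlongrightarrow> 0) (at k)"
    by (rule Lim_null_comparison[rotated])
      (use angle_lipschitz_at[of k] in \<open>auto simp: abs_minus_commute\<close>)
  then show "((\<lambda>l. angle l 1) \<longlongrightarrow> angle k 1) (at k)" by (simp add: LIM_zero_iff)
qed

text \<open>For a very negative parameter \<open>-L\<close> the angle cannot exceed \<open>\<pi>/4\<close> at the end points of \<open>N\<close>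
  equal pieces of the interval. The positive part of the speed is at most \<open>C\<close>, so on one piece the
  angle rises by at most \<open>\<pi>/8\<close>. An angle that ended above \<open>\<pi>/4\<close> would therefore have
  stayed in \<open>[\<pi>/8, 3\<pi>/8]\<close> on the whole piece, where the weight term pulls it
  down by at least \<open>L (sin (\<pi>/8))\<^sup>2 \<integral> w\<close>; \<open>L\<close> is chosen such that this cancels the largest possible rise.\<close>

lemma angle_small: "\<exists>l. angle l 1 < pi"
proof -
  define C where "C = (1 + M)^2"
  have C: "0 \<le> C" by (simp add: C_def)
  obtain N :: nat where N: "8 * C / pi < real N" using reals_Archimedean2 by blast
  have N0: "0 < N" using N C by (intro gr0I) (auto simp: divide_less_0_iff)
  have CN: "C * (1 / real N) \<le> pi / 8" using N N0 by (simp add: field_simps)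
  let ?p = "\<lambda>j. real j / real N"
  have p01: "0 \<le> ?p j" "?p j < ?p (Suc j)" "?p (Suc j) \<le> 1" "?p (Suc j) - ?p j = 1 / real N" if "j < N" for j
    using that by (auto simp: field_simps)
  define W where "W j = integral {?p j..?p (Suc j)} w" for j
  have Wpos: "0 < W j" if "j < N" for j
    unfolding W_def
  proof (rule integral_pos[OF w_int])
    show "0 < w x" if "x \<in> {?p j<..?p (Suc j)}" for x
      by (rule w_pos) (use that p01[OF \<open>j < N\<close>] in \<open>auto intro: order_trans[of _ "?p j"]\<close>)
    show "0 \<le> w (?p j)"
      by (rule less_imp_le[OF w_pos]) (use that in auto)
  qed (use p01[OF that] in auto)
  define c where "c = Min (W ` {..<N})"
  have cW: "c \<le> W j" if "j < N" for j unfolding c_def using that by simp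
  have cpos: "0 < c" unfolding c_def using N0 Wpos by (subst Min_gr_iff) auto
  define s where "s = (sin (pi/8))^2"
  have "0 < sin (pi/8)" by (rule sin_gt_zero) auto
  then have spos: "0 < s" by (simp add: s_def)
  define L where "L = pi / 8 / (s * c)"
  have L: "0 < L" "L * s * c = pi / 8" using spos cpos by (auto simp: L_def)
  let ?\<theta> = "angle (-L)"
  have up: "?\<theta> t - ?\<theta> r \<le> C * (t - r)" if "0 \<le> r" "r \<le> t" "t \<le> 1" for r t
  proof -
    have "?\<theta> t - ?\<theta> r = integral {r..t} (\<lambda>x. speed (-L) x (?\<theta> x))"
      by (rule ac_deriv_diff[OF angle(2) that])
    also have "\<dots> \<le> integral {r..t} (\<lambda>x. C)"
    proof (rule integral_le)
      fix x assume x: "x \<in> {r..t}"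
      then have "0 \<le> L * w x * (sin (?\<theta> x))^2"
        using L(1) w_pos[of x] that by (intro mult_nonneg_nonneg) auto
      then show "speed (-L) x (?\<theta> x) \<le> C"
        using square_first_term_bound[of x "?\<theta> x"] x that by (simp add: speed_def C_def)
    qed (use abs_int_imp_int[OF ac_derivD(1)[OF angle(2)]] that in auto)
    finally show ?thesis using that by (simp add: mult.commute)
  qed
  have "?\<theta> (?p j) \<le> pi / 4" if "j \<le> N" for j
    using that
  proof (induction j)
    case 0
    then show ?case by (simp add: angle(1))
  next
    case (Suc j)
    then have j: "j < N" and IH: "?\<theta> (?p j) \<le> pi / 4" by auto
    note p = p01[OF j]
    show ?case
    proof (rule ccontr)
      assume "\<not> ?\<theta> (?p (Suc j)) \<le> pi / 4"
      then have neg: "pi / 4 < ?\<theta> (?p (Suc j))" by simp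
      have sq: "s \<le> (sin (?\<theta> x))^2" if x: "x \<in> {?p j..?p (Suc j)}" for x
      proof -
        have "C * (x - ?p j) \<le> C * (1 / real N)" "C * (?p (Suc j) - x) \<le> C * (1 / real N)"
          using x p(4) C by (intro mult_left_mono; simp)+
        moreover have x0: "0 \<le> x" using p(1) x by (meson atLeastAtMost_iff order_trans)
        moreover have "?\<theta> x - ?\<theta> (?p j) \<le> C * (x - ?p j)"
          by (rule up) (use x p in auto)
        moreover have "?\<theta> (?p (Suc j)) - ?\<theta> x \<le> C * (?p (Suc j) - x)"
          by (rule up) (use x p x0 in auto)
        ultimately have "?\<theta> x \<le> pi / 4 + pi / 8" "pi / 4 - pi / 8 \<le> ?\<theta> x"
          using CN IH neg by linarith+
        then have "sin (pi/8) \<le> sin (?\<theta> x)"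
          by (intro sin_monotone_2pi_le) auto
        then show ?thesis unfolding s_def using \<open>0 < sin (pi/8)\<close> by (intro power_mono) auto
      qed
      have "?\<theta> (?p (Suc j)) - ?\<theta> (?p j) = integral {?p j..?p (Suc j)} (\<lambda>x. speed (-L) x (?\<theta> x))"
        by (rule ac_deriv_diff[OF angle(2)]) (use p in auto)
      also have "\<dots> \<le> integral {?p j..?p (Suc j)} (\<lambda>x. C - (L * s) * w x)"
      proof (rule integral_le)
        fix x assume x: "x \<in> {?p j..?p (Suc j)}"
        then have x1: "x \<in> {0..1}" using p(1,3) by (meson atLeastAtMost_iff order_trans)
        have "L * w x * s \<le> L * w x * (sin (?\<theta> x))^2"
          using sq[OF x] L(1) w_pos[OF x1] by (intro mult_left_mono) auto
        then show "speed (-L) x (?\<theta> x) \<le> C - (L * s) * w x"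
          using square_first_term_bound[OF x1, of "?\<theta> x"] by (simp add: speed_def C_def mult_ac)
      next
        have "(\<lambda>x. C - (L * s) * w x) absolutely_integrable_on {0..1}"
          using w_int by (intro set_integral_diff set_integrable_mult_right) auto
        then show "(\<lambda>x. C - (L * s) * w x) integrable_on {?p j..?p (Suc j)}"
          by (rule abs_int_imp_int) (use p in auto)
      qed (use abs_int_imp_int[OF ac_derivD(1)[OF angle(2)]] p in auto)
      also have "\<dots> = C * (1 / real N) - L * s * W j"
      proof -
        have "(\<lambda>x. (L * s) * w x) integrable_on {?p j..?p (Suc j)}"
          using abs_int_imp_int[OF set_integrable_mult_right[of "L * s", OF w_int]] p by auto
        then show ?thesis
          using p by (subst Henstock_Kurzweil_Integration.integral_diff) (auto simp: W_def)
      qed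
      also have "\<dots> \<le> pi / 8 - L * s * c"
        using CN cW[OF j] L(1) spos by (intro diff_mono mult_left_mono) auto
      also have "\<dots> = 0" using L(2) by simp
      finally show False using IH neg by simp
    qed
  qed
  from this[of N] have "?\<theta> 1 \<le> pi / 4" using N0 by simp
  then show ?thesis by (intro exI[of _ "-L"]) (use pi_gt_zero in linarith)
qed

section \<open>Counting multiples of \<open>\<pi>\<close>\<close>

definition levels :: "real \<Rightarrow> real set" where
  "levels l = {t. \<exists>n::int. 1 \<le> n \<and> t = of_int n * pi \<and> t < angle l 1}"

lemma finite_levels: "finite (levels l)"
proof (rule finite_subset)
  show "levels l \<subseteq> (\<lambda>n. of_int n * pi) ` {1..\<lceil>angle l 1 / pi\<rceil>}"
  proof
    fix t assume "t \<in> levels l"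
    then obtain n :: int where n: "1 \<le> n" "t = of_int n * pi" "t < angle l 1"
      by (auto simp: levels_def)
    then have "of_int n \<le> angle l 1 / pi" by (simp add: field_simps)
    then have "n \<le> \<lceil>angle l 1 / pi\<rceil>" by linarith
    then show "t \<in> (\<lambda>n. of_int n * pi) ` {1..\<lceil>angle l 1 / pi\<rceil>}" using n by auto
  qed
qed simp

lemma zeros_biject_levels:
  "bij_betw (angle l) {x \<in> {0<..<1}. sin (angle l x) = 0} (levels l)"
  unfolding bij_betw_def
proof
  have neq: "angle l x \<noteq> angle l y" if x: "x \<in> {0<..<1}" "sin (angle l x) = 0" "y \<in> {0<..<1}" "x < y" for x y
  proof -
    obtain n :: int where "angle l x = of_int n * pi" using x(2) by (auto simp: sin_zero_iff_int2)
    then show ?thesis using angle_crosses_upward[of x y n l] x by auto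
  qed
  show "inj_on (angle l) {x \<in> {0<..<1}. sin (angle l x) = 0}"
  proof (rule inj_onI)
    fix x y assume "x \<in> {x \<in> {0<..<1}. sin (angle l x) = 0}" "y \<in> {x \<in> {0<..<1}. sin (angle l x) = 0}"
      "angle l x = angle l y"
    then show "x = y" using neq[of x y] neq[of y x] by (cases x y rule: linorder_cases) auto
  qed
  show "angle l ` {x \<in> {0<..<1}. sin (angle l x) = 0} = levels l"
  proof safe
    fix x assume x: "x \<in> {0<..<1}" "sin (angle l x) = 0"
    then obtain n :: int where n: "angle l x = of_int n * pi" by (auto simp: sin_zero_iff_int2)
    have "0 < of_int n * pi" using angle_pos[of x l] x n by auto
    then have "1 \<le> n" by (simp add: zero_less_mult_iff)
    moreover have "of_int n * pi < angle l 1" using angle_crosses_upward[of x 1 n l] x n by auto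
    ultimately show "angle l x \<in> levels l" using n by (auto simp: levels_def)
  next
    fix t assume "t \<in> levels l"
    then obtain n :: int where n: "1 \<le> n" "t = of_int n * pi" "t < angle l 1" by (auto simp: levels_def)
    have t: "0 < t" using n by simp
    obtain x where x: "0 \<le> x" "x \<le> 1" "angle l x = t"
      using IVT'[of "angle l" 0 t 1] angle(1)[of l] angle_continuous[of l] n t by auto
    then have "x \<noteq> 0" "x \<noteq> 1" using angle(1)[of l] t n by auto
    then show "t \<in> angle l ` {x \<in> {0<..<1}. sin (angle l x) = 0}"
      using x n by (intro image_eqI[of _ _ x]) (auto simp: sin_zero_iff_int2)
  qed
qed

lemma eigenvalues_biject_levels:
  "bij_betw (\<lambda>k. angle k 1) {k. k < l \<and> sin (angle k 1) = 0} (levels l)"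
  unfolding bij_betw_def
proof
  show "inj_on (\<lambda>k. angle k 1) {k. k < l \<and> sin (angle k 1) = 0}"
    by (rule inj_onI) (metis angle_strict_mono less_irrefl linorder_neqE_linordered_idom)
  show "(\<lambda>k. angle k 1) ` {k. k < l \<and> sin (angle k 1) = 0} = levels l"
  proof safe
    fix k assume k: "k < l" "sin (angle k 1) = 0"
    then obtain n :: int where n: "angle k 1 = of_int n * pi" by (auto simp: sin_zero_iff_int2)
    have "0 < of_int n * pi" using angle_pos[of 1 k] n by auto
    then have "1 \<le> n" by (simp add: zero_less_mult_iff)
    then show "angle k 1 \<in> levels l" using n angle_strict_mono[OF k(1)] by (auto simp: levels_def)
  next
    fix t assume "t \<in> levels l"
    then obtain n :: int where n: "1 \<le> n" "t = of_int n * pi" "t < angle l 1" by (auto simp: levels_def)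
    obtain k0 where k0: "angle k0 1 < pi" using angle_small by auto
    have "1 * pi \<le> of_int n * pi" using n(1) by (intro mult_right_mono) auto
    then have t: "angle k0 1 < t" using k0 unfolding n(2) by linarith
    have "k0 \<le> l" using t n(3) angle_strict_mono[of l k0] by fastforce
    then obtain k where k: "k0 \<le> k" "k \<le> l" "angle k 1 = t"
      using IVT'[of "\<lambda>k. angle k 1" k0 t l] t n(3) continuous_on_subset[OF angle_continuous_parameter]
      by auto
    then have "k \<noteq> l" using n by auto
    then show "t \<in> (\<lambda>k. angle k 1) ` {k. k < l \<and> sin (angle k 1) = 0}"
      using k n by (intro image_eqI[of _ _ k]) (auto simp: sin_zero_iff_int2)
  qed
qed

lemma card_zeros_eq_card_eigenvalues:
  "finite {x \<in> {0<..<1}. sin (angle l x) = 0}"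
  "card {x \<in> {0<..<1}. sin (angle l x) = 0} = card {k. k < l \<and> sin (angle k 1) = 0}"
  using bij_betw_finite[OF zeros_biject_levels] finite_levels
    bij_betw_same_card[OF zeros_biject_levels, of l] bij_betw_same_card[OF eigenvalues_biject_levels, of l]
  by auto

end

section \<open>Riemann--Stieltjes integrals of continuous functions\<close>

text \<open>The witness is the total variation on \<open>[0, x]\<close>. Its monotonicity makes bounds on
  Riemann--Stieltjes sums telescope and gives measurability.\<close>

lemma bounded_variation_dominated:
  assumes "bounded_variation_on g 0 1"
  obtains T where "\<And>a b. 0 \<le> a \<Longrightarrow> a \<le> b \<Longrightarrow> b \<le> 1 \<Longrightarrow> \<bar>g b - g a\<bar> \<le> T b - T a"
proof -
  let ?S = "\<lambda>d. \<Sum>K\<in>d. \<bar>g (Sup K) - g (Inf K)\<bar>"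
  obtain B where B: "\<And>d. d division_of {0..1} \<Longrightarrow> ?S d \<le> B"
    using assms unfolding bounded_variation_on_def by blast
  define T where "T x = Sup {?S d |d. d division_of {0..x}}" for x :: real
  have extend: "\<exists>d'. d' division_of {0..b} \<and> ?S d' = ?S d + \<bar>g b - g a\<bar>"
    if d: "d division_of {0..a}" and ab: "0 \<le> a" "a < b" for d a b
  proof (intro exI conjI)
    have "{{a..b}} division_of {a..b}" using division_of_self[of a b] ab by simp
    then have "(d \<union> {{a..b}}) division_of ({0..a} \<union> {a..b})"
      by (rule division_disjoint_union[OF d]) auto
    moreover have "{0..a} \<union> {a..b} = {0..b}" using ab by auto
    ultimately show "insert {a..b} d division_of {0..b}" by simp
    have "{a..b} \<notin> d"
    proof
      assume "{a..b} \<in> d"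
      then have "{a..b} \<subseteq> {0..a}" using d by (auto dest: division_ofD(2))
      then show False using ab by auto
    qed
    then show "?S (insert {a..b} d) = ?S d + \<bar>g b - g a\<bar>"
      using division_ofD(1)[OF d] ab by simp
  qed
  have bdd: "bdd_above {?S d |d. d division_of {0..x}}" if x: "0 \<le> x" "x \<le> 1" for x
  proof (rule bdd_aboveI)
    fix v assume "v \<in> {?S d |d. d division_of {0..x}}"
    then obtain d where d: "d division_of {0..x}" "v = ?S d" by auto
    show "v \<le> B"
    proof (cases "x = 1")
      case True
      then show ?thesis using B d by auto
    next
      case False
      then obtain d' where d': "d' division_of {0..1}" "?S d' = ?S d + \<bar>g 1 - g x\<bar>"
        using extend[OF d(1), of 1] x by auto
      then show ?thesis using B[OF d'(1)] d(2) by linarith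
    qed
  qed
  have "\<bar>g b - g a\<bar> \<le> T b - T a" if ab: "0 \<le> a" "a \<le> b" "b \<le> 1" for a b
  proof (cases "a = b")
    case False
    have "{{0..a}} division_of {0..a}" using division_of_self[of 0 a] ab by simp
    then have ne: "{?S d |d. d division_of {0..a}} \<noteq> {}" by blast
    have "T a \<le> T b - \<bar>g b - g a\<bar>"
      unfolding T_def[of a]
    proof (rule cSup_least[OF ne])
      fix v assume "v \<in> {?S d |d. d division_of {0..a}}"
      then obtain d where d: "d division_of {0..a}" "v = ?S d" by auto
      obtain d' where d': "d' division_of {0..b}" "?S d' = ?S d + \<bar>g b - g a\<bar>"
        using extend[OF d(1), of b] ab False by auto
      have "?S d' \<in> {?S d |d. d division_of {0..b}}" using d'(1) by blast
      then have "?S d' \<le> T b" unfolding T_def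
        by (rule cSup_upper[OF _ bdd]) (use ab in auto)
      then show "v \<le> T b - \<bar>g b - g a\<bar>" using d d' by simp
    qed
    then show ?thesis by simp
  qed simp
  then show thesis using that by blast
qed

lemma mono_on_measurable:
  fixes f :: "real \<Rightarrow> real"
  assumes "mono_on {0..1} f"
  shows "f \<in> borel_measurable (lebesgue_on {0..1})"
proof -
  have "(\<lambda>x. indicator {0..1} x *\<^sub>R f x) \<in> borel_measurable borel"
    using borel_measurable_mono_on_fnc[OF assms] by (subst (asm) borel_measurable_restrict_space_iff) auto
  then have "(\<lambda>x. indicator {0..1} x *\<^sub>R f x) \<in> borel_measurable lebesgue"
    by (auto intro: measurable_completion)
  then show ?thesis by (subst borel_measurable_restrict_space_iff) auto
qed

abbreviation rs_sum :: "(real \<Rightarrow> complex) \<Rightarrow> (real \<Rightarrow> real) \<Rightarrow> (real \<times> real set) set \<Rightarrow> complex" where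
  "rs_sum f g p \<equiv> \<Sum>(t, K)\<in>p. complex_of_real (g (Sup K) - g (Inf K)) * f t"

lemma tagged_division_interval:
  assumes "p tagged_division_of {a..b::real}" "(t, K) \<in> p"
  obtains c d where "K = {c..d}" "a \<le> c" "c \<le> t" "t \<le> d" "d \<le> b" "Sup K = d" "Inf K = c"
proof -
  obtain c d where K: "K = {c..d}" using tagged_division_ofD(4)[OF assms] by auto
  moreover have "t \<in> K" by (rule tagged_division_ofD(2)[OF assms])
  moreover have "K \<subseteq> {a..b}" by (rule tagged_division_ofD(3)[OF assms])
  ultimately show thesis using that[of c d] by auto
qed

lemma has_rs_integralE:
  assumes "has_rs_integral f g a b I" "0 < e"
  obtains d where "0 < d"
    "\<And>p. p tagged_division_of {a..b} \<Longrightarrow> (\<lambda>t. ball t d) fine p \<Longrightarrow> norm (rs_sum f g p - I) < e"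
proof -
  from assms(1)[unfolded has_rs_integral_def, rule_format, OF assms(2)]
  obtain d where "0 < d \<and> (\<forall>p. p tagged_division_of {a..b} \<and> (\<lambda>t. ball t d) fine p \<longrightarrow> norm (rs_sum f g p - I) < e)" ..
  then show thesis by (intro that[of d]) auto
qed

lemma has_rs_integral_unique:
  assumes "has_rs_integral f g a b I" "has_rs_integral f g a b J"
  shows "I = J"
proof (rule ccontr)
  assume "I \<noteq> J"
  define e where "e = norm (I - J) / 2"
  have e: "0 < e" using \<open>I \<noteq> J\<close> by (simp add: e_def)
  obtain d1 where d1: "d1 > 0" "\<And>p. p tagged_division_of {a..b} \<Longrightarrow> (\<lambda>t. ball t d1) fine p \<Longrightarrow> norm (rs_sum f g p - I) < e"
    by (rule has_rs_integralE[OF assms(1) e]) (rule that)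
  obtain d2 where d2: "d2 > 0" "\<And>p. p tagged_division_of {a..b} \<Longrightarrow> (\<lambda>t. ball t d2) fine p \<Longrightarrow> norm (rs_sum f g p - J) < e"
    by (rule has_rs_integralE[OF assms(2) e]) (rule that)
  have ga: "gauge (\<lambda>t. ball t d1 \<inter> ball t d2)" using d1(1) d2(1) by (intro gauge_Int gauge_ball)
  obtain p where p: "p tagged_division_of {a..b}" "(\<lambda>t. ball t d1 \<inter> ball t d2) fine p"
    using fine_division_exists_real[OF ga] by metis
  have "norm (I - J) \<le> norm (rs_sum f g p - J) + norm (rs_sum f g p - I)"
    using norm_triangle_ineq4[of "rs_sum f g p - J" "rs_sum f g p - I"] by simp
  also have "\<dots> < e + e"
    using d1(2)[OF p(1)] d2(2)[OF p(1)] p(2)[unfolded fine_Int] by linarith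
  finally show False by (simp add: e_def)
qed

lemma has_rs_integral_refl: "has_rs_integral f g a a 0"
proof -
  have "rs_sum f g p = 0" if "p tagged_division_of {a..a}" for p
  proof (rule sum.neutral, clarify)
    fix t K assume "(t, K) \<in> p"
    then have "Sup K = Inf K" by (rule tagged_division_interval[OF that]) linarith
    then show "complex_of_real (g (Sup K) - g (Inf K)) * f t = 0" by simp
  qed
  then show ?thesis unfolding has_rs_integral_def by (auto intro: exI[of _ 1])
qed

lemma rs_sum_bound:
  assumes dom: "\<And>a b. 0 \<le> a \<Longrightarrow> a \<le> b \<Longrightarrow> b \<le> 1 \<Longrightarrow> \<bar>g b - g a\<bar> \<le> T b - T a"
    and p: "p tagged_division_of {a..b}" and ab: "0 \<le> a" "a \<le> b" "b \<le> 1"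
    and f: "\<And>t. t \<in> {0..1} \<Longrightarrow> norm (f t) \<le> B"
  shows "norm (rs_sum f g p) \<le> B * (T b - T a)"
proof -
  have "norm (rs_sum f g p) \<le> (\<Sum>(t, K)\<in>p. B * (T (Sup K) - T (Inf K)))"
  proof (rule sum_norm_le, clarify)
    fix t K assume tK: "(t, K) \<in> p"
    obtain c d where K: "K = {c..d}" "a \<le> c" "c \<le> t" "t \<le> d" "d \<le> b" "Sup K = d" "Inf K = c"
      by (rule tagged_division_interval[OF p tK])
    have "\<bar>g d - g c\<bar> * norm (f t) \<le> (T d - T c) * B"
      using dom[of c d] f[of t] K ab by (intro mult_mono) auto
    then show "norm (complex_of_real (g (Sup K) - g (Inf K)) * f t) \<le> B * (T (Sup K) - T (Inf K))"
      unfolding norm_mult norm_of_real K(6,7) by (simp add: mult.commute)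
  qed
  also have "\<dots> = B * (T b) - B * (T a)"
    using additive_tagged_division_1[OF ab(2) p, of "\<lambda>x. B * T x"] by (simp add: right_diff_distrib)
  finally show ?thesis by (simp add: right_diff_distrib)
qed

text \<open>Fine divisions of \<open>[0, a]\<close> and \<open>[a, b]\<close> join to one of \<open>[0, b]\<close>. The consequence wanted is that the
  indefinite Riemann--Stieltjes integral differs from a monotone function by a monotone function,
  hence is measurable.\<close>

lemma has_rs_integral_increment:
  assumes dom: "\<And>a b. 0 \<le> a \<Longrightarrow> a \<le> b \<Longrightarrow> b \<le> 1 \<Longrightarrow> \<bar>g b - g a\<bar> \<le> T b - T a"
    and f: "\<And>t. t \<in> {0..1} \<Longrightarrow> norm (f t) \<le> B"
    and I: "has_rs_integral f g 0 a I" and J: "has_rs_integral f g 0 b J"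
    and ab: "0 \<le> a" "a \<le> b" "b \<le> 1"
  shows "norm (J - I) \<le> B * (T b - T a)"
proof (rule field_le_epsilon)
  fix e :: real assume "0 < e"
  then have e: "0 < e / 2" by simp
  obtain d1 where d1: "d1 > 0" "\<And>p. p tagged_division_of {0..a} \<Longrightarrow> (\<lambda>t. ball t d1) fine p \<Longrightarrow> norm (rs_sum f g p - I) < e / 2"
    by (rule has_rs_integralE[OF I e]) (rule that)
  obtain d2 where d2: "d2 > 0" "\<And>p. p tagged_division_of {0..b} \<Longrightarrow> (\<lambda>t. ball t d2) fine p \<Longrightarrow> norm (rs_sum f g p - J) < e / 2"
    by (rule has_rs_integralE[OF J e]) (rule that)
  have ga: "gauge (\<lambda>t. ball t d1 \<inter> ball t d2)" using d1(1) d2(1) by (intro gauge_Int gauge_ball)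
  obtain p where p: "p tagged_division_of {0..a}" "(\<lambda>t. ball t d1 \<inter> ball t d2) fine p"
    using fine_division_exists_real[OF ga] by metis
  obtain q where q: "q tagged_division_of {a..b}" "(\<lambda>t. ball t d1 \<inter> ball t d2) fine q"
    using fine_division_exists_real[OF ga] by metis
  have "p \<union> q tagged_division_of ({0..a} \<union> {a..b})"
    by (rule tagged_division_Un[OF p(1) q(1)]) auto
  moreover have "{0..a} \<union> {a..b} = {0..b}" using ab by auto
  ultimately have pq: "p \<union> q tagged_division_of {0..b}" by simp
  have "(\<lambda>t. ball t d2) fine (p \<union> q)" 
    by (rule fine_Un[OF conjunct2[OF p(2)[unfolded fine_Int]] conjunct2[OF q(2)[unfolded fine_Int]]])
  then have 1: "norm (rs_sum f g (p \<union> q) - J) < e / 2" by (rule d2(2)[OF pq])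
  have 2: "norm (rs_sum f g p - I) < e / 2" using d1(2)[OF p(1)] p(2)[unfolded fine_Int] by blast
  have 3: "rs_sum f g (p \<union> q) = rs_sum f g p + rs_sum f g q"
  proof (rule sum.union_inter_neutral)
    show "finite p" "finite q" using tagged_division_of_finite p q by auto
    show "\<forall>x\<in>p \<inter> q. (case x of (t, K) \<Rightarrow> complex_of_real (g (Sup K) - g (Inf K)) * f t) = 0"
    proof clarify
      fix t K assume tp: "(t, K) \<in> p" and tq: "(t, K) \<in> q"
      have "Sup K \<le> a" "Inf K \<le> Sup K" by (rule tagged_division_interval[OF p(1) tp]; linarith)+
      moreover have "a \<le> Inf K" by (rule tagged_division_interval[OF q(1) tq]; linarith)
      ultimately have "Sup K = Inf K" by simp
      then show "complex_of_real (g (Sup K) - g (Inf K)) * f t = 0" by simp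
    qed
  qed
  have 4: "norm (rs_sum f g q) \<le> B * (T b - T a)"
    by (rule rs_sum_bound[OF dom q(1) ab f])
  have "norm (J - I) = norm (rs_sum f g q + (rs_sum f g p - I) - (rs_sum f g (p \<union> q) - J))"
    using 3 by simp
  also have "\<dots> \<le> norm (rs_sum f g q) + norm (rs_sum f g p - I) + norm (rs_sum f g (p \<union> q) - J)"
    by (meson norm_triangle_ineq norm_triangle_ineq4 order_trans add_right_mono)
  finally show "norm (J - I) \<le> B * (T b - T a) + e" using 1 2 4 by linarith
qed

lemma abs_int_real_complex_mult:
  fixes g :: "real \<Rightarrow> real" and y :: "real \<Rightarrow> complex"
  assumes "g \<in> borel_measurable (lebesgue_on {0..1})" "bounded (g ` {0..1})" "y absolutely_integrable_on {0..1}"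
  shows "(\<lambda>s. complex_of_real (g s) * y s) absolutely_integrable_on {0..1}"
proof -
  have "bilinear (\<lambda>(a::real) (b::complex). complex_of_real a * b)"
    unfolding bilinear_conv_bounded_bilinear scaleR_conv_of_real[symmetric]
    by (rule bounded_bilinear_scaleR)
  then show ?thesis
    by (rule absolutely_integrable_bounded_measurable_product) (use assms in auto)
qed

lemma abs_int_real_complex_cont_mult:
  fixes g :: "real \<Rightarrow> real" and y :: "real \<Rightarrow> complex"
  assumes g: "g absolutely_integrable_on {0..1}" and y: "continuous_on {0..1} y"
  shows "(\<lambda>s. complex_of_real (g s) * y s) absolutely_integrable_on {0..1}"
proof -
  have "bilinear (\<lambda>(b::complex) (a::real). complex_of_real a * b)"
    unfolding bilinear_conv_bounded_bilinear scaleR_conv_of_real[symmetric]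
    by (rule bounded_bilinear.flip[OF bounded_bilinear_scaleR])
  then show ?thesis
  proof (rule absolutely_integrable_bounded_measurable_product)
    show "y \<in> borel_measurable (lebesgue_on {0..1})"
      by (rule continuous_imp_measurable_on_sets_lebesgue[OF y]) simp
    show "bounded (y ` {0..1})"
      by (intro compact_imp_bounded compact_continuous_image y) simp
  qed (use g in auto)
qed

lemma norm_neg_diff_le: "norm (- a - b) \<le> norm a + norm b" for a b :: "'a::real_normed_vector"
  using norm_triangle_ineq4[of "- a" b] by simp

text \<open>On a piece \<open>[c, d]\<close> with tag \<open>t\<close> the Riemann--Stieltjes summand differs from the increment of the
  right-hand side by integrals of \<open>(g s - g d) Z s\<close> over \<open>[t, d]\<close> and of \<open>(g s - g c) Z s\<close> over
  \<open>[c, t]\<close>, which is at most \<open>B (T d - T c) (d - c)\<close>. The factors \<open>T d - T c\<close> telescope and the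
  mesh bounds the factors \<open>d - c\<close>.\<close>

lemma has_rs_integral_by_parts:
  fixes Y Z :: "real \<Rightarrow> complex"
  assumes dom: "\<And>a b. 0 \<le> a \<Longrightarrow> a \<le> b \<Longrightarrow> b \<le> 1 \<Longrightarrow> \<bar>g b - g a\<bar> \<le> T b - T a"
    and g: "g \<in> borel_measurable (lebesgue_on {0..1})" "bounded (g ` {0..1})"
    and Z: "Z absolutely_integrable_on {0..1}" "\<And>t. t \<in> {0..1} \<Longrightarrow> norm (Z t) \<le> B"
    and Y: "\<And>x. x \<in> {0..1} \<Longrightarrow> Y x = Y 0 + integral {0..x} Z"
    and x: "x \<in> {0..1}"
  shows "has_rs_integral Y g 0 x (g x * Y x - g 0 * Y 0 - integral {0..x} (\<lambda>s. g s * Z s))"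
proof -
  have iG: "(\<lambda>s. complex_of_real (g s) * Z s) absolutely_integrable_on {0..1}"
    by (rule abs_int_real_complex_mult[OF g Z(1)])
  have Ydiff: "Y d - Y c = integral {c..d} Z" if "0 \<le> c" "c \<le> d" "d \<le> 1" for c d
    using Y[of c] Y[of d] integral_diff_interval[OF Z(1) that] that by simp
  have B0: "0 \<le> B" using Z(2)[of 0] by (auto intro: order_trans[OF norm_ge_zero])
  define J where "J r = g r * Y r - integral {0..r} (\<lambda>s. g s * Z s)" for r
  have part: "norm (g r * (Y d - Y c) - integral {c..d} (\<lambda>s. g s * Z s)) \<le> (B * (T v - T u)) * (d - c)"
    if "0 \<le> u" "u \<le> c" "c \<le> d" "d \<le> v" "v \<le> 1" "r \<in> {u..v}" for c d r u v
  proof -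
    have i1: "(\<lambda>s. complex_of_real (g r) * Z s) absolutely_integrable_on {0..1}"
      using Z(1) by (rule set_integrable_mult_right)
    have "g r * (Y d - Y c) - integral {c..d} (\<lambda>s. g s * Z s)
        = integral {c..d} (\<lambda>s. g r * Z s - g s * Z s)"
      using that Ydiff[of c d] abs_int_imp_int[OF i1] abs_int_imp_int[OF iG]
      by (subst Henstock_Kurzweil_Integration.integral_diff) auto
    also have "norm \<dots> \<le> integral {c..d} (\<lambda>s. B * (T v - T u))"
    proof (rule Henstock_Kurzweil_Integration.integral_norm_bound_integral)
      show "(\<lambda>s. g r * Z s - g s * Z s) integrable_on {c..d}"
        using that abs_int_imp_int[OF i1] abs_int_imp_int[OF iG]
        by (intro Henstock_Kurzweil_Integration.integrable_diff) auto
      fix s assume s: "s \<in> {c..d}"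
      have mono: "T a \<le> T b" if "0 \<le> a" "a \<le> b" "b \<le> 1" for a b
        using dom[OF that] by linarith
      have "\<bar>g r - g s\<bar> \<le> T v - T u"
        using dom[of s r] dom[of r s] mono[of u s] mono[of u r] mono[of s v] mono[of r v] s that
        by (cases "r \<le> s") auto
      then have "\<bar>g r - g s\<bar> * norm (Z s) \<le> (T v - T u) * B"
        using Z(2)[of s] s that by (intro mult_mono) auto
      moreover have "norm (g r * Z s - g s * Z s) = \<bar>g r - g s\<bar> * norm (Z s)"
        by (metis left_diff_distrib norm_mult norm_of_real of_real_diff)
      ultimately show "norm (g r * Z s - g s * Z s) \<le> B * (T v - T u)" by (simp add: mult.commute)
    qed auto
    also have "\<dots> = (B * (T v - T u)) * (d - c)" using that by simp
    finally show ?thesis .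
  qed
  have "has_rs_integral Y g 0 x (J x - J 0)"
    unfolding has_rs_integral_def
  proof (intro allI impI)
    fix e :: real assume e: "0 < e"
    define V where "V = B * (T x - T 0)"
    have V: "0 \<le> V" using B0 dom[of 0 x] x by (simp add: V_def)
    define r where "r = e / (2 * (V + 1))"
    have r: "0 < r" using e V by (simp add: r_def)
    have rV: "2 * r * V < e" using e V by (simp add: r_def field_simps)
    have "norm (rs_sum Y g p - (J x - J 0)) < e"
      if p: "p tagged_division_of {0..x}" and fine: "(\<lambda>t. ball t r) fine p" for p
    proof -
      have "rs_sum Y g p - (J x - J 0)
          = (\<Sum>(t, K)\<in>p. complex_of_real (g (Sup K) - g (Inf K)) * Y t - (J (Sup K) - J (Inf K)))"
        using additive_tagged_division_1[of 0 x p J] p x by (simp add: sum_subtractf case_prod_unfold)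
      also have "norm \<dots> \<le> (\<Sum>(t, K)\<in>p. (2 * r) * (B * (T (Sup K) - T (Inf K))))"
      proof (rule sum_norm_le, clarify)
        fix t K assume tK: "(t, K) \<in> p"
        obtain c d where K: "K = {c..d}" "0 \<le> c" "c \<le> t" "t \<le> d" "d \<le> x" "Sup K = d" "Inf K = c"
          by (rule tagged_division_interval[OF p tK])
        have d1: "d \<le> 1" using K x by auto
        have "{c..d} \<subseteq> ball t r" using fineD[OF fine tK] K(1) by simp
        moreover have "c \<in> {c..d}" "d \<in> {c..d}" using K by auto
        ultimately have "c \<in> ball t r" "d \<in> ball t r" by (meson subsetD)+
        then have cd: "d - c \<le> 2 * r" by (auto simp: dist_real_def)
        have split: "integral {c..d} (\<lambda>s. g s * Z s) = integral {c..t} (\<lambda>s. g s * Z s) + integral {t..d} (\<lambda>s. g s * Z s)"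
          using integral_diff_interval[OF iG, of 0 t] integral_diff_interval[OF iG, of c t]
            integral_diff_interval[OF iG, of t d] integral_diff_interval[OF iG, of c d] K d1
          by (auto simp: algebra_simps)
        have "complex_of_real (g d - g c) * Y t - (J d - J c)
            = - (g d * (Y d - Y t) - integral {t..d} (\<lambda>s. g s * Z s))
              - (g c * (Y t - Y c) - integral {c..t} (\<lambda>s. g s * Z s))"
          using integral_diff_interval[OF iG, of c d] K d1 split
          by (simp add: J_def algebra_simps)
        also have "norm \<dots> \<le> norm (g d * (Y d - Y t) - integral {t..d} (\<lambda>s. g s * Z s))
              + norm (g c * (Y t - Y c) - integral {c..t} (\<lambda>s. g s * Z s))"
          by (rule norm_neg_diff_le)
        also have "\<dots> \<le> (B * (T d - T c)) * (d - t) + (B * (T d - T c)) * (t - c)"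
          by (intro add_mono part) (use K d1 in auto)
        also have "\<dots> = (B * (T d - T c)) * (d - c)" by (simp add: algebra_simps)
        also have "\<dots> \<le> (B * (T d - T c)) * (2 * r)"
          using cd B0 dom[of c d] K d1 by (intro mult_left_mono) auto
        finally show "norm (complex_of_real (g (Sup K) - g (Inf K)) * Y t - (J (Sup K) - J (Inf K)))
            \<le> (2 * r) * (B * (T (Sup K) - T (Inf K)))"
          unfolding K(6,7) by (simp add: mult.commute)
      qed
      also have "\<dots> = (2 * r) * V"
        using additive_tagged_division_1[of 0 x p "\<lambda>s. (2 * r) * (B * T s)"] p x
        by (simp add: V_def right_diff_distrib)
      finally show ?thesis using rV by linarith
    qed
    then show "\<exists>\<delta>>0. \<forall>p. p tagged_division_of {0..x} \<and> (\<lambda>t. ball t \<delta>) fine p \<longrightarrow>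
        norm (rs_sum Y g p - (J x - J 0)) < e"
      by (intro exI[of _ r] conjI allI impI r) (elim conjE)
  qed
  moreover have "J x - J 0 = g x * Y x - g 0 * Y 0 - integral {0..x} (\<lambda>s. g s * Z s)"
    by (simp add: J_def)
  ultimately show ?thesis by simp
qed

section \<open>From the measure equation to the angle\<close>

text \<open>The trigonometric algebra behind the polar coordinates: for \<open>s = sin \<theta>\<close> and \<open>c = cos \<theta>\<close> the
  quantity \<open>\<omega>\<close> is the speed of the angle and \<open>-\<rho>\<close> the logarithmic derivative of the radius, when
  \<open>m\<close> stands for the value of \<open>\<mu>\<close> and \<open>q\<close> for that of \<open>\<mu>\<^sup>2 + \<lambda> w\<close>.\<close>

lemma rotation_identities:
  fixes s c :: real
  assumes sc: "s^2 + c^2 = 1"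
  defines "\<rho> \<equiv> \<lambda>m q. m * (c^2 - s^2) + (q - 1) * (s * c)"
  defines "\<omega> \<equiv> \<lambda>m q. (c + m * s)^2 + (q - m^2) * s^2"
  shows rotation_kernel: "(m * y + v) * c + y * (- s * \<omega> m q) - ((- m * v - q * y) * s + v * (c * \<omega> m q))
           = (y * c - v * s) * \<rho> m q"
    and rotation_radius: "y * c - v * s = 0 \<Longrightarrow>
        (m * y + v) * s + y * (c * \<omega> m q) + ((- m * v - q * y) * c + v * (- s * \<omega> m q)) = - \<rho> m q * (y * s + v * c)"
    and rotation_sin: "c * \<omega> m q - \<rho> m q * s = m * s + c"
    and rotation_cos: "- s * \<omega> m q - \<rho> m q * c = - m * c - q * s"
  unfolding \<rho>_def \<omega>_def using sc by algebra+

locale prufer_variation = prufer +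
  fixes T :: "real \<Rightarrow> real"
  assumes dom: "\<And>a b. 0 \<le> a \<Longrightarrow> a \<le> b \<Longrightarrow> b \<le> 1 \<Longrightarrow> \<bar>\<mu> b - \<mu> a\<bar> \<le> T b - T a"

context prufer
begin

definition potential :: "real \<Rightarrow> real \<Rightarrow> real" where
  "potential l x = (\<mu> x)^2 + l * w x"

text \<open>The measure equation for \<open>y\<close> with the jumps of the generalized derivative removed.\<close>

definition quasi_system :: "real \<Rightarrow> (real \<Rightarrow> real) \<Rightarrow> (real \<Rightarrow> real) \<Rightarrow> bool" where
  "quasi_system l y v \<longleftrightarrow>
     ac_deriv y (\<lambda>x. \<mu> x * y x + v x) \<and> ac_deriv v (\<lambda>x. - \<mu> x * v x - potential l x * y x)"

definition log_rate :: "real \<Rightarrow> real \<Rightarrow> real" where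
  "log_rate l x = \<mu> x * ((cos (angle l x))^2 - (sin (angle l x))^2)
     + (potential l x - 1) * (sin (angle l x) * cos (angle l x))"

definition radius :: "real \<Rightarrow> real \<Rightarrow> real" where
  "radius l x = exp (-1 * (0 + integral {0..x} (log_rate l)))"

lemma speed_potential: "speed l x t = (cos t + \<mu> x * sin t)^2 + (potential l x - (\<mu> x)^2) * (sin t)^2"
  by (simp add: speed_def potential_def)

lemma mu_bounded: "bounded (\<mu> ` {0..1})"
  unfolding bounded_iff using mu_bound by (intro exI[of _ M]) auto

lemma mu_int: "\<mu> absolutely_integrable_on {0..1}"
  by (rule measurable_bounded_by_integrable_imp_absolutely_integrable[OF mu_meas, of "\<lambda>_. M"])
    (use mu_bound in auto)

lemma potential_int: "potential l absolutely_integrable_on {0..1}"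
proof -
  have "(\<lambda>x. \<mu> x * \<mu> x) absolutely_integrable_on {0..1}"
    by (rule absolutely_integrable_bounded_measurable_product_real[OF mu_meas _ mu_bounded mu_int]) simp
  then show ?thesis
    unfolding potential_def power2_eq_square by (intro set_integral_add set_integrable_mult_right w_int)
qed

lemma log_rate_int: "log_rate l absolutely_integrable_on {0..1}"
proof -
  have "(\<lambda>x. ((cos (angle l x))^2 - (sin (angle l x))^2) * \<mu> x
     + (sin (angle l x) * cos (angle l x)) * (potential l x - 1)) absolutely_integrable_on {0..1}"
    by (intro set_integral_add set_integral_diff abs_int_cont_mult mu_int potential_int
        continuous_intros angle_continuous) auto
  then show ?thesis unfolding log_rate_def by (simp add: mult.commute)
qed

lemma radius: "0 < radius l x" "radius l 0 = 1"
  "ac_deriv (radius l) (\<lambda>x. radius l x * (-1 * log_rate l x))"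
  unfolding radius_def
  by (simp, simp) (intro ac_deriv_exp ac_deriv_cmult ac_deriv_indefinite log_rate_int)

lemma quasi_system_polar:
  "quasi_system l (\<lambda>x. radius l x * sin (angle l x)) (\<lambda>x. radius l x * cos (angle l x))"
  unfolding quasi_system_def
proof
  have "ac_deriv (\<lambda>x. radius l x * sin (angle l x))
     (\<lambda>x. (radius l x * (-1 * log_rate l x)) * sin (angle l x) + radius l x * (cos (angle l x) * speed l x (angle l x)))"
    by (intro ac_deriv_mult radius ac_deriv_sin angle)
  then show "ac_deriv (\<lambda>x. radius l x * sin (angle l x))
     (\<lambda>x. \<mu> x * (radius l x * sin (angle l x)) + radius l x * cos (angle l x))"
  proof (rule ac_deriv_cong)
    fix x
    have "radius l x * (cos (angle l x) * speed l x (angle l x) - log_rate l x * sin (angle l x))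
        = radius l x * (\<mu> x * sin (angle l x) + cos (angle l x))"
      unfolding speed_potential log_rate_def by (subst rotation_sin) simp_all
    then show "\<mu> x * (radius l x * sin (angle l x)) + radius l x * cos (angle l x)
       = (radius l x * (-1 * log_rate l x)) * sin (angle l x) + radius l x * (cos (angle l x) * speed l x (angle l x))"
      by (simp add: algebra_simps)
  qed simp
next
  have "ac_deriv (\<lambda>x. radius l x * cos (angle l x))
     (\<lambda>x. (radius l x * (-1 * log_rate l x)) * cos (angle l x) + radius l x * (- sin (angle l x) * speed l x (angle l x)))"
    by (intro ac_deriv_mult radius ac_deriv_cos angle)
  then show "ac_deriv (\<lambda>x. radius l x * cos (angle l x))
     (\<lambda>x. - \<mu> x * (radius l x * cos (angle l x)) - potential l x * (radius l x * sin (angle l x)))"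
  proof (rule ac_deriv_cong)
    fix x
    have "radius l x * (- sin (angle l x) * speed l x (angle l x) - log_rate l x * cos (angle l x))
        = radius l x * (- \<mu> x * cos (angle l x) - potential l x * sin (angle l x))"
      unfolding speed_potential log_rate_def by (subst rotation_cos) simp_all
    then show "- \<mu> x * (radius l x * cos (angle l x)) - potential l x * (radius l x * sin (angle l x))
       = (radius l x * (-1 * log_rate l x)) * cos (angle l x) + radius l x * (- sin (angle l x) * speed l x (angle l x))"
      by (simp add: algebra_simps)
  qed simp
qed

lemma ac_deriv_zero_imp_const:
  assumes "ac_deriv f (\<lambda>x. 0)" "x \<in> {0..1}"
  shows "f x = f 0"
  using ac_derivD(2)[OF assms] by simp

text \<open>In the frame rotating with the angle, the component \<open>D\<close> of \<open>(v, y)\<close> orthogonal to the direction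
  \<open>(cos \<theta>, sin \<theta>)\<close> satisfies a homogeneous linear equation and vanishes at 0, hence everywhere; the
  other component \<open>C\<close> then satisfies the equation of the radius.\<close>

lemma quasi_system_unique:
  assumes sys: "quasi_system l y v" and y0: "y 0 = 0" and x: "x \<in> {0..1}"
  shows "y x = v 0 * (radius l x * sin (angle l x))"
proof -
  let ?s = "\<lambda>x. sin (angle l x)" and ?c = "\<lambda>x. cos (angle l x)"
  let ?\<omega> = "\<lambda>x. speed l x (angle l x)"
  let ?y' = "\<lambda>x. \<mu> x * y x + v x" and ?v' = "\<lambda>x. - \<mu> x * v x - potential l x * y x"
  have y: "ac_deriv y ?y'" and v: "ac_deriv v ?v'" using sys by (auto simp: quasi_system_def)
  define D where "D x = y x * ?c x - v x * ?s x" for x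
  define C where "C x = y x * ?s x + v x * ?c x" for x
  have "ac_deriv D (\<lambda>x. (?y' x * ?c x + y x * (- ?s x * ?\<omega> x)) - (?v' x * ?s x + v x * (?c x * ?\<omega> x)))"
    unfolding D_def by (intro ac_deriv_diff_fun ac_deriv_mult y v ac_deriv_sin ac_deriv_cos angle)
  then have acD: "ac_deriv D (\<lambda>x. D x * log_rate l x)"
    unfolding D_def log_rate_def speed_potential
    by (rule ac_deriv_cong) (rule refl, rule rotation_kernel[symmetric], simp)
  have "ac_deriv (\<lambda>x. radius l x * D x) (\<lambda>x. (radius l x * (-1 * log_rate l x)) * D x + radius l x * (D x * log_rate l x))"
    by (intro ac_deriv_mult radius acD)
  then have "ac_deriv (\<lambda>x. radius l x * D x) (\<lambda>x. 0)"
    by (rule ac_deriv_cong) (auto simp: algebra_simps)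
  then have "radius l z * D z = radius l 0 * D 0" if "z \<in> {0..1}" for z
    by (rule ac_deriv_zero_imp_const) (rule that)
  moreover have "D 0 = 0" by (simp add: D_def y0 angle(1))
  ultimately have D0: "D z = 0" if "z \<in> {0..1}" for z
    using that radius(1)[of l z] by fastforce
  have "ac_deriv C (\<lambda>x. (?y' x * ?s x + y x * (?c x * ?\<omega> x)) + (?v' x * ?c x + v x * (- ?s x * ?\<omega> x)))"
    unfolding C_def by (intro ac_deriv_add ac_deriv_mult y v ac_deriv_sin ac_deriv_cos angle)
  then have acC: "ac_deriv C (\<lambda>x. - log_rate l x * C x)"
  proof (rule ac_deriv_cong)
    fix z :: real assume "z \<in> {0..1}"
    then have "y z * ?c z - v z * ?s z = 0" using D0[of z] by (simp add: D_def)
    then show "- log_rate l z * C z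
        = (?y' z * ?s z + y z * (?c z * ?\<omega> z)) + (?v' z * ?c z + v z * (- ?s z * ?\<omega> z))"
      unfolding C_def log_rate_def speed_potential by (subst rotation_radius) simp_all
  qed simp
  define P where "P x = exp (1 * (0 + integral {0..x} (log_rate l)))" for x
  have acP: "ac_deriv P (\<lambda>x. P x * (1 * log_rate l x))"
    unfolding P_def by (intro ac_deriv_exp ac_deriv_cmult ac_deriv_indefinite log_rate_int)
  have PR: "radius l x * P x = 1" by (simp add: P_def radius_def exp_add[symmetric])
  have "ac_deriv (\<lambda>x. P x * C x) (\<lambda>x. (P x * (1 * log_rate l x)) * C x + P x * (- log_rate l x * C x))"
    by (intro ac_deriv_mult acP acC)
  then have "ac_deriv (\<lambda>x. P x * C x) (\<lambda>x. 0)"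
    by (rule ac_deriv_cong) auto
  then have "P x * C x = P 0 * C 0" by (rule ac_deriv_zero_imp_const[OF _ x])
  also have "\<dots> = v 0" by (simp add: P_def C_def y0 angle(1))
  finally have "radius l x * P x * C x = v 0 * radius l x" by (simp add: mult_ac)
  then have C: "C x = v 0 * radius l x" using PR by simp
  have "y x = C x * ?s x + D x * ?c x"
  proof -
    have "C x * ?s x + D x * ?c x = y x * ((?s x)^2 + (?c x)^2)"
      unfolding C_def D_def by algebra
    then show ?thesis by simp
  qed
  then show ?thesis using C D0[OF x] by simp
qed

end

context prufer_variation
begin

lemma quasi_system_imp_mde_solution:
  assumes sys: "quasi_system l y v" and y0: "y 0 = 0"
  shows "mde_solution w \<mu> (of_real l) (\<lambda>x. of_real (y x)) (\<lambda>x. of_real (\<mu> x * y x + v x))"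
proof -
  define z where "z x = \<mu> x * y x + v x" for x
  have y: "ac_deriv y z" and v: "ac_deriv v (\<lambda>x. - \<mu> x * v x - potential l x * y x)"
    using sys unfolding quasi_system_def z_def[abs_def] by blast+
  note cy = ac_deriv_continuous[OF y] and cv = ac_deriv_continuous[OF v]
  have zi: "z absolutely_integrable_on {0..1}" by (rule ac_derivD(1)[OF y])
  have of_real_int: "(\<lambda>x. complex_of_real (f x)) absolutely_integrable_on {0..1}"
    if "f absolutely_integrable_on {0..1}" for f :: "real \<Rightarrow> real"
    using absolutely_integrable_linear[OF that bounded_linear_of_real] by (simp add: o_def)
  have of_real_integral: "integral {0..x} (\<lambda>x. complex_of_real (f x)) = of_real (integral {0..x} f)"
    if "f absolutely_integrable_on {0..1}" "x \<in> {0..1}" for f :: "real \<Rightarrow> real" and x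
    using integral_linear[OF abs_int_imp_int[OF that(1)] bounded_linear_of_real, of 0 x] that(2) by (simp add: o_def)
  obtain By where By: "\<And>x. x \<in> {0..1} \<Longrightarrow> \<bar>y x\<bar> \<le> By"
    using compact_imp_bounded[OF compact_continuous_image[OF cy compact_Icc]]
    unfolding bounded_iff by (metis image_eqI real_norm_def)
  obtain Bv where Bv: "\<And>x. x \<in> {0..1} \<Longrightarrow> \<bar>v x\<bar> \<le> Bv"
    using compact_imp_bounded[OF compact_continuous_image[OF cv compact_Icc]]
    unfolding bounded_iff by (metis image_eqI real_norm_def)
  have zB: "norm (complex_of_real (z x)) \<le> M * By + Bv" if "x \<in> {0..1}" for x
  proof -
    have "\<bar>\<mu> x * y x\<bar> \<le> M * By"
      unfolding abs_mult by (rule mult_mono) (use mu_bound By that M_nonneg in auto)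
    then show ?thesis using Bv[OF that] unfolding norm_of_real z_def by linarith
  qed
  have muz: "(\<lambda>x. \<mu> x * z x) absolutely_integrable_on {0..1}"
    by (rule absolutely_integrable_bounded_measurable_product_real[OF mu_meas _ mu_bounded zi]) simp
  have wy: "(\<lambda>x. w x * y x) absolutely_integrable_on {0..1}"
    using abs_int_cont_mult[OF cy w_int] by (simp add: mult.commute)
  have set_int: "(LINT s:{0..x}|lebesgue. f s) = integral {0..x} f"
    if "f absolutely_integrable_on {0..1}" "x \<in> {0..1}" for f :: "real \<Rightarrow> complex" and x
    by (rule set_lebesgue_integral_eq_integral(2)[OF abs_int_sub[OF that(1)]]) (use that in auto)
  have yint: "complex_of_real (y x) = of_real (y 0) + integral {0..x} (\<lambda>x. complex_of_real (z x))"
    if x: "x \<in> {0..1}" for x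
    unfolding of_real_integral[OF zi x] of_real_add[symmetric] using ac_derivD(2)[OF y x] by (rule arg_cong)
  have rs: "has_rs_integral (\<lambda>x. of_real (y x)) \<mu> 0 x
      (\<mu> x * complex_of_real (y x) - \<mu> 0 * complex_of_real (y 0) - integral {0..x} (\<lambda>s. \<mu> s * complex_of_real (z s)))"
    if x: "x \<in> {0..1}" for x
    by (rule has_rs_integral_by_parts[OF dom mu_meas mu_bounded of_real_int[OF zi] zB yint x])
  show ?thesis
    unfolding mde_solution_def z_def[symmetric]
  proof (intro conjI exI ballI)
    show "continuous_on {0..1} (\<lambda>x. complex_of_real (y x))" by (intro continuous_intros cy)
    fix x :: real assume x: "x \<in> {0..1}"
    show "complex_of_real (y x) = 0 + (LINT s:{0..x}|lebesgue. complex_of_real (z s))"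
      using set_int[OF of_real_int[OF zi] x] yint[OF x] by (simp add: y0)
  next
    show "complex_of_real (z 0) = of_real (v 0)" by (simp add: z_def y0)
  next
    fix x :: real assume "x \<in> {0<..1}"
    then have x: "x \<in> {0..1}" by auto
    show "has_rs_integral (\<lambda>x. of_real (y x)) \<mu> 0 x
      (\<mu> x * complex_of_real (y x) - \<mu> 0 * complex_of_real (y 0) - integral {0..x} (\<lambda>s. \<mu> s * complex_of_real (z s)))"
      by (rule rs[OF x])
    have 1: "(LINT s:{0..x}|lebesgue. complex_of_real (w s) * of_real (y s)) = of_real (integral {0..x} (\<lambda>s. w s * y s))"
      using set_int[OF of_real_int[OF wy] x] of_real_integral[OF wy x] by simp
    have 2: "integral {0..x} (\<lambda>s. \<mu> s * complex_of_real (z s)) = of_real (integral {0..x} (\<lambda>s. \<mu> s * z s))"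
      using of_real_integral[OF muz x] by simp
    have "v x = v 0 + integral {0..x} (\<lambda>s. - \<mu> s * v s - potential l s * y s)"
      by (rule ac_derivD(2)[OF v x])
    also have "(\<lambda>s. - \<mu> s * v s - potential l s * y s) = (\<lambda>s. (-1) * (\<mu> s * z s) - l * (w s * y s))"
      by (auto simp: z_def potential_def power2_eq_square algebra_simps)
    also have "integral {0..x} \<dots> = - integral {0..x} (\<lambda>s. \<mu> s * z s) - l * integral {0..x} (\<lambda>s. w s * y s)"
      using x abs_int_imp_int[OF set_integrable_mult_right[OF muz, of "-1"]] abs_int_imp_int[OF set_integrable_mult_right[OF wy, of l]]
      by (subst Henstock_Kurzweil_Integration.integral_diff) auto
    finally have "z x = v 0 + (\<mu> x * y x - \<mu> 0 * y 0 - integral {0..x} (\<lambda>s. \<mu> s * z s)) - l * integral {0..x} (\<lambda>s. w s * y s)"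
      by (simp add: z_def y0)
    then show "complex_of_real (z x) = of_real (v 0)
        + (\<mu> x * complex_of_real (y x) - \<mu> 0 * complex_of_real (y 0) - integral {0..x} (\<lambda>s. \<mu> s * complex_of_real (z s)))
        - of_real l * (LINT s:{0..x}|lebesgue. complex_of_real (w s) * of_real (y s))"
      unfolding 1 2 by (simp only: of_real_add of_real_diff of_real_mult)
  qed
qed

text \<open>In the measure equation the integral of \<open>z\<close> has the value 0 by default if \<open>z\<close> is not integrable;
  this excludes that case. The Riemann--Stieltjes part is measurable because adding \<open>B T\<close>
  makes its real and imaginary parts monotone.\<close>

lemma mde_solution_derivative_bounded:
  assumes sol: "mde_solution w \<mu> l y z"
  obtains B where "\<And>x. x \<in> {0..1} \<Longrightarrow> norm (z x) \<le> B" "z absolutely_integrable_on {0..1}"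
proof -
  obtain y0 z0 where cy: "continuous_on {0..1} y" and z0: "z 0 = z0"
    and "\<forall>x\<in>{0<..1}. \<exists>I. has_rs_integral y \<mu> 0 x I \<and>
           z x = z0 + I - l * (LINT s:{0..x}|lebesgue. complex_of_real (w s) * y s)"
    using sol unfolding mde_solution_def by blast
  then obtain I where I: "\<And>x. x \<in> {0<..1} \<Longrightarrow> has_rs_integral y \<mu> 0 x (I x)"
    "\<And>x. x \<in> {0<..1} \<Longrightarrow> z x = z0 + I x - l * (LINT s:{0..x}|lebesgue. complex_of_real (w s) * y s)"
    by metis
  define J where "J x = (if x = 0 then 0 else I x)" for x
  have J: "has_rs_integral y \<mu> 0 x (J x)" if "x \<in> {0..1}" for x
    using I(1)[of x] has_rs_integral_refl that by (auto simp: J_def)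
  have wy: "(\<lambda>s. complex_of_real (w s) * y s) absolutely_integrable_on {0..1}"
    by (rule abs_int_real_complex_cont_mult[OF w_int cy])
  define L where "L x = integral {0..x} (\<lambda>s. complex_of_real (w s) * y s)" for x
  have zJ: "z x = z0 + J x - l * L x" if "x \<in> {0..1}" for x
    using that I(2)[of x] z0 set_lebesgue_integral_eq_integral(2)[OF abs_int_sub[OF wy, of 0 x]]
    by (auto simp: J_def L_def)
  have cL: "continuous_on {0..1} L"
    unfolding L_def by (rule indefinite_integral_continuous_1)
      (use abs_int_imp_int[OF wy, of 0 1] in simp)
  obtain B where B: "\<And>x. x \<in> {0..1} \<Longrightarrow> norm (y x) \<le> B"
    using compact_imp_bounded[OF compact_continuous_image[OF cy compact_Icc]]
    unfolding bounded_iff by (metis image_eqI)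
  have B0: "0 \<le> B" using B[of 0] by (auto intro: order_trans[OF norm_ge_zero])
  have inc: "norm (J b - J a) \<le> B * T b - B * T a" if "0 \<le> a" "a \<le> b" "b \<le> 1" for a b
    using has_rs_integral_increment[OF dom B J J that] that by (auto simp: right_diff_distrib)
  have BT: "mono_on {0..1} (\<lambda>x. B * T x)"
  proof (rule mono_onI)
    fix a b :: real assume "a \<in> {0..1}" "b \<in> {0..1}" "a \<le> b"
    then have "norm (J b - J a) \<le> B * T b - B * T a" by (intro inc) auto
    then show "B * T a \<le> B * T b" using norm_ge_zero[of "J b - J a"] by linarith
  qed
  have meas: "(\<lambda>x. h (J x)) \<in> borel_measurable (lebesgue_on {0..1})"
    if h: "\<And>u v. h u - h v = h (u - v)" "\<And>u. \<bar>h u\<bar> \<le> norm u" for h :: "complex \<Rightarrow> real"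
  proof -
    have "mono_on {0..1} (\<lambda>x. h (J x) + B * T x)"
    proof (rule mono_onI)
      fix a b :: real assume ab: "a \<in> {0..1}" "b \<in> {0..1}" "a \<le> b"
      have "\<bar>h (J b) - h (J a)\<bar> \<le> B * T b - B * T a"
        using inc[of a b] h(2)[of "J b - J a"] ab by (auto simp: h(1))
      then show "h (J a) + B * T a \<le> h (J b) + B * T b" by linarith
    qed
    from borel_measurable_diff[OF mono_on_measurable[OF this] mono_on_measurable[OF BT]]
    show ?thesis by simp
  qed
  have Jm: "J \<in> borel_measurable (lebesgue_on {0..1})"
    unfolding borel_measurable_complex_iff by (intro conjI meas) (auto simp: abs_Re_le_cmod abs_Im_le_cmod)
  have Lm: "L \<in> borel_measurable (lebesgue_on {0..1})"
    by (rule continuous_imp_measurable_on_sets_lebesgue[OF cL]) simp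
  obtain BL where BL: "\<And>x. x \<in> {0..1} \<Longrightarrow> norm (L x) \<le> BL"
    using compact_imp_bounded[OF compact_continuous_image[OF cL compact_Icc]]
    unfolding bounded_iff by (metis image_eqI)
  define Bz where "Bz = norm z0 + (B * T 1 - B * T 0) + norm l * BL"
  have Bz: "norm (z x) \<le> Bz" if x: "x \<in> {0..1}" for x
  proof -
    have "norm (J x) \<le> B * T x - B * T 0" using inc[of 0 x] x by (simp add: J_def)
    also have "\<dots> \<le> B * T 1 - B * T 0"
      using mono_onD[OF BT, of x 1] x by simp
    finally have "norm (J x) \<le> B * T 1 - B * T 0" .
    moreover have "norm (l * L x) \<le> norm l * BL" using BL[OF x] by (simp add: norm_mult mult_left_mono)
    moreover have "norm (z x) \<le> norm z0 + norm (J x) + norm (l * L x)"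
      unfolding zJ[OF x] by (meson norm_triangle_ineq norm_triangle_ineq4 order_trans add_right_mono)
    ultimately show ?thesis unfolding Bz_def by linarith
  qed
  have "z absolutely_integrable_on {0..1}"
  proof (rule measurable_bounded_by_integrable_imp_absolutely_integrable)
    have "(\<lambda>x. z0 + J x - l * L x) \<in> borel_measurable (lebesgue_on {0..1})"
      by (intro borel_measurable_add borel_measurable_diff borel_measurable_times Jm Lm) auto
    then show "z \<in> borel_measurable (lebesgue_on {0..1})"
      by (rule measurable_cong[THEN iffD1, rotated]) (use zJ in auto)
    show "(\<lambda>x::real. Bz) integrable_on {0..1}" by (rule integrable_const_ivl)
  qed (use Bz in auto)
  then show thesis using that Bz by blast
qed

text \<open>Real and imaginary part are treated separately since an eigenfunction is complex-valued and the
  system is real.\<close>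

lemma mde_solution_imp_quasi_system:
  assumes sol: "mde_solution w \<mu> (of_real l) y z" and y0: "y 0 = 0" and h: "h = Re \<or> h = Im"
  obtains v where "quasi_system l (\<lambda>x. h (y x)) v"
proof -
  obtain B where B: "\<And>x. x \<in> {0..1} \<Longrightarrow> norm (z x) \<le> B" and zi: "z absolutely_integrable_on {0..1}"
    using mde_solution_derivative_bounded[OF sol] by blast
  obtain y1 z0 where cy: "continuous_on {0..1} y" and z0: "z 0 = z0"
    and yz: "\<And>x. x \<in> {0..1} \<Longrightarrow> y x = y1 + (LINT s:{0..x}|lebesgue. z s)"
    and zI: "\<And>x. x \<in> {0<..1} \<Longrightarrow> \<exists>I. has_rs_integral y \<mu> 0 x I \<and>
           z x = z0 + I - of_real l * (LINT s:{0..x}|lebesgue. complex_of_real (w s) * y s)"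
    using sol unfolding mde_solution_def by blast
  have set_int: "(LINT s:{0..x}|lebesgue. f s) = integral {0..x} f"
    if "f absolutely_integrable_on {0..1}" "x \<in> {0..1}" for f :: "real \<Rightarrow> complex" and x
    by (rule set_lebesgue_integral_eq_integral(2)[OF abs_int_sub[OF that(1)]]) (use that in auto)
  have yz': "y x = y1 + integral {0..x} z" if "x \<in> {0..1}" for x
    using yz[OF that] set_int[OF zi that] by simp
  have "y1 = 0" using yz'[of 0] y0 by simp
  then have yint: "y x = y 0 + integral {0..x} z" if "x \<in> {0..1}" for x
    using yz'[OF that] y0 by simp
  have wy: "(\<lambda>s. complex_of_real (w s) * y s) absolutely_integrable_on {0..1}"
    by (rule abs_int_real_complex_cont_mult[OF w_int cy])
  have muz: "(\<lambda>s. complex_of_real (\<mu> s) * z s) absolutely_integrable_on {0..1}"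
    by (rule abs_int_real_complex_mult[OF mu_meas mu_bounded zi])
  have zx: "z x = z0 + \<mu> x * y x - integral {0..x} (\<lambda>s. complex_of_real (\<mu> s) * z s)
      - of_real l * integral {0..x} (\<lambda>s. complex_of_real (w s) * y s)" if x: "x \<in> {0..1}" for x
  proof (cases "x = 0")
    case True
    then show ?thesis using z0 y0 by simp
  next
    case False
    then have "x \<in> {0<..1}" using x by auto
    then obtain I where I: "has_rs_integral y \<mu> 0 x I"
      "z x = z0 + I - of_real l * (LINT s:{0..x}|lebesgue. complex_of_real (w s) * y s)"
      using zI by blast
    have "has_rs_integral y \<mu> 0 x (\<mu> x * y x - \<mu> 0 * y 0 - integral {0..x} (\<lambda>s. complex_of_real (\<mu> s) * z s))"
      by (rule has_rs_integral_by_parts[OF dom mu_meas mu_bounded zi B yint x])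
    then have "I = \<mu> x * y x - \<mu> 0 * y 0 - integral {0..x} (\<lambda>s. complex_of_real (\<mu> s) * z s)"
      by (rule has_rs_integral_unique[OF I(1)])
    then show ?thesis using I(2) set_int[OF wy x] y0 by simp
  qed
  have bl: "bounded_linear h" using h bounded_linear_Re bounded_linear_Im by auto
  have hm: "h (complex_of_real r * u) = r * h u" for r u using h by auto
  have hadd: "h (a + b) = h a + h b" "h (a - b) = h a - h b" for a b using h by auto
  have hint: "(\<lambda>x. h (f x)) absolutely_integrable_on {0..1}"
    if "f absolutely_integrable_on {0..1}" for f :: "real \<Rightarrow> complex"
    using absolutely_integrable_linear[OF that bl] by (simp add: o_def)
  have hintegral: "integral {0..x} (\<lambda>x. h (f x)) = h (integral {0..x} f)"
    if "f absolutely_integrable_on {0..1}" "x \<in> {0..1}" for f :: "real \<Rightarrow> complex" and x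
    using integral_linear[OF abs_int_imp_int[OF that(1)] bl, of 0 x] that(2) by (simp add: o_def)
  define Y where "Y x = h (y x)" for x
  define v where "v x = h (z x) - \<mu> x * Y x" for x
  have acY: "ac_deriv Y (\<lambda>x. h (z x))"
    unfolding ac_deriv_def
  proof (intro conjI ballI)
    fix x :: real assume x: "x \<in> {0..1}"
    have "y x - y 0 = integral {0..x} z" using yint[OF x] by (metis add_diff_cancel_left')
    then show "Y x - Y 0 = integral {0..x} (\<lambda>x. h (z x))"
      using hintegral[OF zi x] hadd(2)[of "y x" "y 0"] by (simp add: Y_def)
  qed (rule hint[OF zi])
  have imuz: "(\<lambda>s. \<mu> s * h (z s)) absolutely_integrable_on {0..1}" using hint[OF muz] by (simp add: hm)
  have iwy: "(\<lambda>s. w s * Y s) absolutely_integrable_on {0..1}" using hint[OF wy] by (simp add: hm Y_def)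
  have vx: "v x = h z0 - integral {0..x} (\<lambda>s. \<mu> s * h (z s)) - l * integral {0..x} (\<lambda>s. w s * Y s)"
    if x: "x \<in> {0..1}" for x
  proof -
    have "h (z x) = h z0 + \<mu> x * Y x - integral {0..x} (\<lambda>s. \<mu> s * h (z s)) - l * integral {0..x} (\<lambda>s. w s * Y s)"
      using hintegral[OF muz x] hintegral[OF wy x] by (subst zx[OF x]) (simp add: hm hadd Y_def)
    then show ?thesis by (simp add: v_def)
  qed
  have "ac_deriv (\<lambda>x. (h z0 + integral {0..x} (\<lambda>s. (-1) * (\<mu> s * h (z s)))) - l * (0 + integral {0..x} (\<lambda>s. w s * Y s)))
     (\<lambda>x. (-1) * (\<mu> x * h (z x)) - l * (w x * Y x))"
    by (intro ac_deriv_diff_fun ac_deriv_cmult ac_deriv_indefinite set_integrable_mult_right imuz iwy)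
  then have acv: "ac_deriv v (\<lambda>x. - \<mu> x * v x - potential l x * Y x)"
  proof (rule ac_deriv_cong)
    fix x :: real assume x: "x \<in> {0..1}"
    show "v x = (h z0 + integral {0..x} (\<lambda>s. (-1) * (\<mu> s * h (z s)))) - l * (0 + integral {0..x} (\<lambda>s. w s * Y s))"
      using vx[OF x] by simp
    show "- \<mu> x * v x - potential l x * Y x = (-1) * (\<mu> x * h (z x)) - l * (w x * Y x)"
      by (simp add: v_def potential_def power2_eq_square algebra_simps)
  qed
  have "ac_deriv Y (\<lambda>x. \<mu> x * Y x + v x)"
    using acY by (simp add: v_def)
  then have "quasi_system l Y v" using acv by (simp add: quasi_system_def)
  then show thesis using that unfolding Y_def by blast
qed

section \<open>Zeros of eigenfunctions\<close>

lemma eigenvalue_iff: "eigenvalue w \<mu> (of_real l) \<longleftrightarrow> sin (angle l 1) = 0"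
proof
  assume "eigenvalue w \<mu> (of_real l)"
  then obtain y z x where sol: "mde_solution w \<mu> (of_real l) y z" and y: "y 0 = 0" "y 1 = 0" "x \<in> {0..1}" "y x \<noteq> 0"
    unfolding eigenvalue_def eigenfunction_def by blast
  have "Re (y x) \<noteq> 0 \<or> Im (y x) \<noteq> 0" using y(4) by (auto simp: complex_eq_iff)
  then obtain h where h: "h = Re \<or> h = Im" "h (y x) \<noteq> 0" by blast
  obtain v where v: "quasi_system l (\<lambda>x. h (y x)) v"
    by (rule mde_solution_imp_quasi_system[OF sol y(1) h(1)])
  have eq: "h (y t) = v 0 * (radius l t * sin (angle l t))" if "t \<in> {0..1}" for t
    by (rule quasi_system_unique[OF v _ that]) (use y(1) h(1) in auto)
  have "v 0 \<noteq> 0" using eq[OF y(3)] h(2) by auto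
  moreover have "h (y 1) = 0" using y(2) h(1) by auto
  ultimately show "sin (angle l 1) = 0" using eq[of 1] radius(1)[of l 1] by auto
next
  assume 0: "sin (angle l 1) = 0"
  let ?y = "\<lambda>x. radius l x * sin (angle l x)"
  obtain e where e: "0 < e" "e \<le> 1" "\<And>x. x \<in> {0<..e} \<Longrightarrow> 0 < sin (angle l x)"
    using sin_angle_pos_near_0[of l] by blast
  have "mde_solution w \<mu> (of_real l) (\<lambda>x. of_real (?y x)) (\<lambda>x. of_real (\<mu> x * ?y x + radius l x * cos (angle l x)))"
    by (rule quasi_system_imp_mde_solution[OF quasi_system_polar]) (simp add: angle(1))
  moreover have "\<exists>x\<in>{0..1}. complex_of_real (?y x) \<noteq> 0"
    using e radius(1)[of l e] by (intro bexI[of _ e]) (auto simp: less_imp_neq[symmetric])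
  ultimately have "eigenfunction w \<mu> (of_real l) (\<lambda>x. of_real (?y x))"
    unfolding eigenfunction_def using 0 angle(1)[of l] by auto
  then show "eigenvalue w \<mu> (of_real l)" unfolding eigenvalue_def by blast
qed

lemma eigenfunction_zero_iff:
  assumes ef: "eigenfunction w \<mu> (of_real l) (\<lambda>x. complex_of_real (y x))" and x: "x \<in> {0..1}"
  shows "y x = 0 \<longleftrightarrow> sin (angle l x) = 0"
proof -
  obtain z t where sol: "mde_solution w \<mu> (of_real l) (\<lambda>x. complex_of_real (y x)) z"
    and y: "y 0 = 0" "t \<in> {0..1}" "y t \<noteq> 0"
    using ef unfolding eigenfunction_def by auto
  obtain v where v: "quasi_system l (\<lambda>x. Re (complex_of_real (y x))) v"
    by (rule mde_solution_imp_quasi_system[OF sol]) (use y in auto)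
  have eq: "y t = v 0 * (radius l t * sin (angle l t))" if "t \<in> {0..1}" for t
    using quasi_system_unique[OF v _ that] y(1) by simp
  have "v 0 \<noteq> 0" using eq[OF y(2)] y(3) by auto
  then show ?thesis using eq[OF x] radius(1)[of l x] by auto
qed

lemma card_zeros_eigenfunction:
  assumes "eigenfunction w \<mu> (of_real l) (\<lambda>x. complex_of_real (y x))"
  shows "finite {x \<in> {0<..<1}. y x = 0}"
    "card {x \<in> {0<..<1}. y x = 0} = card {k. k < l \<and> eigenvalue w \<mu> (complex_of_real k)}"
proof -
  have "{x \<in> {0<..<1}. y x = 0} = {x \<in> {0<..<1}. sin (angle l x) = 0}"
    using eigenfunction_zero_iff[OF assms] by auto
  then show "finite {x \<in> {0<..<1}. y x = 0}"
    "card {x \<in> {0<..<1}. y x = 0} = card {k. k < l \<and> eigenvalue w \<mu> (complex_of_real k)}"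
    using card_zeros_eq_card_eigenvalues[of l] by (simp_all add: eigenvalue_iff)
qed

end

text \<open>Changing the weight on a null set allows it to be assumed positive everywhere.\<close>

lemma mde_solution_weight_cong:
  assumes w: "w absolutely_integrable_on {0..1}" and N: "negligible N"
    and W: "\<And>x. x \<in> {0..1} - N \<Longrightarrow> W x = w x"
  shows "mde_solution w \<mu> l y z \<longleftrightarrow> mde_solution W \<mu> l y z"
proof (cases "continuous_on {0..1} y")
  case True
  have Wi: "W absolutely_integrable_on {0..1}"
    by (rule absolutely_integrable_spike[OF w N W])
  have "(LINT s:{0..x}|lebesgue. complex_of_real (w s) * y s) = (LINT s:{0..x}|lebesgue. complex_of_real (W s) * y s)"
    if x: "x \<in> {0<..1}" for x
  proof -
    have 1: "(\<lambda>s. complex_of_real (w s) * y s) absolutely_integrable_on {0..x}"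
      by (rule abs_int_sub[OF abs_int_real_complex_cont_mult[OF w True]]) (use x in auto)
    have 2: "(\<lambda>s. complex_of_real (W s) * y s) absolutely_integrable_on {0..x}"
      by (rule abs_int_sub[OF abs_int_real_complex_cont_mult[OF Wi True]]) (use x in auto)
    show ?thesis
      unfolding set_lebesgue_integral_eq_integral(2)[OF 1] set_lebesgue_integral_eq_integral(2)[OF 2]
      by (rule integral_spike[OF N]) (use W x in auto)
  qed
  then show ?thesis unfolding mde_solution_def by auto
next
  case False
  then show ?thesis by (simp add: mde_solution_def)
qed

theorem theoremA8:
  fixes w \<mu> :: "real \<Rightarrow> real" and m :: nat and l :: real and y :: "real \<Rightarrow> real"
  assumes "w absolutely_integrable_on {0..1}"
    and "AE x in lebesgue_on {0..1}. w x > 0"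
    and "\<mu> \<in> normalized_measures"
    and "m \<ge> 1"
    and "mth_eigenvalue w \<mu> m l"
    and "eigenfunction w \<mu> (complex_of_real l) (\<lambda>x. complex_of_real (y x))"
  shows "finite {x \<in> {0<..<1}. y x = 0} \<and> card {x \<in> {0<..<1}. y x = 0} = m - 1"
proof -
  have "AE x in lebesgue. x \<in> {0..1} \<longrightarrow> 0 < w x"
    using assms(2) by (subst (asm) AE_restrict_space_iff) auto
  then obtain N where neg: "negligible N" and N: "{x. \<not> (x \<in> {0..1} \<longrightarrow> 0 < w x)} \<subseteq> N"
    unfolding eventually_ae_filter_negligible by blast
  define W where "W x = (if x \<in> N then 1 else w x)" for x
  have Ww: "W x = w x" if "x \<in> {0..1} - N" for x using that by (simp add: W_def)
  have Wint: "W absolutely_integrable_on {0..1}"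
    by (rule absolutely_integrable_spike[OF assms(1) neg Ww])
  have Wpos: "0 < W x" if "x \<in> {0..1}" for x using N that by (auto simp: W_def)
  have "mde_solution w \<mu> k u = mde_solution W \<mu> k u" for k u
    by (rule ext) (rule mde_solution_weight_cong[OF assms(1) neg Ww])
  then have ef: "eigenfunction w \<mu> k u \<longleftrightarrow> eigenfunction W \<mu> k u" for k u
    unfolding eigenfunction_def by simp
  then have ev: "eigenvalue w \<mu> k \<longleftrightarrow> eigenvalue W \<mu> k" for k
    by (simp add: eigenvalue_def)
  have "bounded_variation_on \<mu> 0 1" using assms(3) by (simp add: normalized_measures_def)
  then obtain T where T: "\<And>a b. 0 \<le> a \<Longrightarrow> a \<le> b \<Longrightarrow> b \<le> 1 \<Longrightarrow> \<bar>\<mu> b - \<mu> a\<bar> \<le> T b - T a"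
    by (rule bounded_variation_dominated) (rule that)
  have "mono_on {0..1} T" "mono_on {0..1} (\<lambda>x. T x - \<mu> x)"
  proof (safe intro!: mono_onI)
    fix a b :: real assume "a \<in> {0..1}" "b \<in> {0..1}" "a \<le> b"
    then show "T a \<le> T b" "T a - \<mu> a \<le> T b - \<mu> b" using T[of a b] by auto
  qed
  from borel_measurable_diff[OF this[THEN mono_on_measurable]]
  have meas: "\<mu> \<in> borel_measurable (lebesgue_on {0..1})" by simp
  define M where "M = \<bar>\<mu> 0\<bar> + (T 1 - T 0)"
  have M: "\<bar>\<mu> x\<bar> \<le> M" if "x \<in> {0..1}" for x
    using T[of 0 x] T[of x 1] that by (auto simp: M_def)
  interpret prufer_variation W \<mu> M T
    by unfold_locales (fact Wint, fact Wpos, fact meas, fact M, fact T)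
  have "card {k. k < l \<and> eigenvalue W \<mu> (complex_of_real k)} = m - 1"
    using assms(5) by (simp add: mth_eigenvalue_def ev)
  then show ?thesis
    using card_zeros_eigenfunction[of l y] assms(6) ef by simp
qed

end
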